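(* Let $\varphi$ be a random product of maps $f_{\theta^i(\omega)}$ on a compact metric space $(X,d)$ over an invertible measure-preserving dynamical system $(\Omega,\mathscr{F},\mathbb{P},\theta)$. Then the following are equivalent: (1) $\displaystyle\lim_{n\to\infty}\mathrm{diam}\big(f_{\theta^{-1}(\omega)}\circ\cdots\circ f_{\theta^{-n}(\omega)}(X)\big)=0$ for $\mathbb{P}$-almost every $\omega$; (2) $\displaystyle\lim_{n\to\infty}\frac1n\sum_{i=1}^{n}\mathrm{diam}\big(f_\omega^{i}(X)\big)=0$ for $\mathbb{P}$-almost every $\omega$.
   Context: Setting. $(\Omega,\mathscr{F},\mathbb{P},\theta)$ is a measure-preserving dynamical system: $(\Omega,\mathscr{F},\mathbb{P})$ is a probability space and $\theta\colon\Omega\to\Omega$ is measurable and preserves $\mathbb{P}$; invertible means that $\theta$ is a bijection with measurable inverse. $(X,d)$ is a compact metric space with Borel $\sigma$-algebra $\mathscr{B}$, and $f\colon\Omega\times X\to X$ is $\mathscr{F}\otimes\mathscr{B}/\mathscr{B}$-measurable; write $f_\omega(x)=f(\omega,x)$. The random product of maps $f_{\theta^i(\omega)}$ over $(\Omega,\mathscr{F},\mathbb{P},\theta)$ is $\varphi(n,\omega,x)=f_\omega^n(x)=f_{\theta^{n-1}(\omega)}\circ\cdots\circ f_\omega(x)$ for $n\ge1$. For $A\subset X$, $\mathrm{diam}(A)=\sup_{x,y\in A}d(x,y)$. *)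

theory Defs
  imports "HOL-Probability.Probability"
begin

text \<open>The cocycle: \<open>random_product \<theta> f n \<omega>\<close> is
  \<open>f (\<theta>^(n-1) \<omega>) \<circ> \<dots> \<circ> f (\<theta> \<omega>) \<circ> f \<omega>\<close>.\<close>

primrec random_product ::
  "('w \<Rightarrow> 'w) \<Rightarrow> ('w \<Rightarrow> 'x \<Rightarrow> 'x) \<Rightarrow> nat \<Rightarrow> 'w \<Rightarrow> 'x \<Rightarrow> 'x"
where
  "random_product \<theta> f 0 \<omega> = id"
| "random_product \<theta> f (Suc n) \<omega> = f ((\<theta> ^^ n) \<omega>) \<circ> random_product \<theta> f n \<omega>"

text \<open>The pullback composition: with \<open>\<tau>\<close> the inverse of the base map,
  \<open>pullback_product \<tau> f n \<omega>\<close> is \<open>f (\<tau> \<omega>) \<circ> f (\<tau>^2 \<omega>) \<circ> \<dots> \<circ> f (\<tau>^n \<omega>)\<close>, so that a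
  new factor is added on the inside.\<close>

primrec pullback_product ::
  "('w \<Rightarrow> 'w) \<Rightarrow> ('w \<Rightarrow> 'x \<Rightarrow> 'x) \<Rightarrow> nat \<Rightarrow> 'w \<Rightarrow> 'x \<Rightarrow> 'x"
where
  "pullback_product \<tau> f 0 \<omega> = id"
| "pullback_product \<tau> f (Suc n) \<omega> = pullback_product \<tau> f n \<omega> \<circ> f ((\<tau> ^^ Suc n) \<omega>)"

end

theory Submission
  imports Defs
begin

text \<open>Let \<open>D n \<omega>\<close> be the diameter of the \<open>n\<close>-th forward image of \<open>X\<close> and \<open>P n \<omega>\<close> that of the
  pullback image, so \<open>P n = D n \<circ> \<tau> ^^ n\<close> with \<open>\<tau>\<close> the inverse of \<open>\<theta>\<close>; hence \<open>P n\<close> and \<open>D n\<close> have the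
  same expectation. Since \<open>P n\<close> decreases in \<open>n\<close>, it tends to 0 almost surely iff
  these expectations tend to 0. If the averages of \<open>D\<close> tend to 0, so do the averages
  of the decreasing sequence of expectations, hence the expectations themselves. Conversely
  \<open>D (i + m) \<omega> \<le> D m ((\<theta> ^^ i) \<omega>)\<close>, so the averages of \<open>D\<close> are asymptotically bounded by
  Birkhoff averages of \<open>D m\<close>, which the maximal ergodic inequality controls by the
  expectation of \<open>D m\<close>.

  As \<open>f\<close> is only measurable, \<open>D n\<close> need not be measurable, but it is for the
  completion of \<open>M\<close>: \<open>{D n > a}\<close> is the projection of a measurable subset of
  \<open>\<Omega> \<times> (X \<times> X)\<close>. The projection theorem is proved by Choquet's capacitability argument
  for Souslin schemes.\<close>

section \<open>Measurable projection along a compact factor\<close>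

lemma compact_decseq_Inter_nonempty:
  fixes F :: "nat \<Rightarrow> 'a::topological_space set"
  assumes comp: "compact (F 0)" and closed: "\<And>n. closed (F n)" and ne: "\<And>n. F n \<noteq> {}" and dec: "\<And>n. F (Suc n) \<subseteq> F n"
  shows "(\<Inter>n. F n) \<noteq> {}"
proof -
  have mono: "F n \<subseteq> F m" if "m \<le> n" for m n
    using that dec by (rule lift_Suc_antimono_le[rotated])
  have "F 0 \<inter> (\<Inter>n\<in>UNIV. F n) \<noteq> {}"
  proof (rule compact_imp_fip_image)
    fix I :: "nat set" assume "finite I" "I \<subseteq> UNIV"
    then obtain N where N: "\<And>i. i \<in> I \<Longrightarrow> i \<le> N"
      using finite_nat_set_iff_bounded_le[of I] by auto
    then have "F N \<subseteq> F 0 \<inter> (\<Inter>n\<in>I. F n)"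
      using mono by blast
    with ne[of N] show "F 0 \<inter> (\<Inter>n\<in>I. F n) \<noteq> {}"
      by blast
  qed (auto intro: comp closed)
  then show ?thesis by blast
qed

text \<open>This is continuity of \<open>K\<close> on Baire space for the discrete topology on the
  target. The length \<open>n\<close> may depend on \<open>\<sigma>\<close>; it becomes uniform on
  compact boxes.\<close>

definition locally_const :: "((nat \<Rightarrow> nat) \<Rightarrow> 'b) \<Rightarrow> bool"
  where "locally_const K \<longleftrightarrow> (\<forall>\<sigma>. \<exists>n. \<forall>\<sigma>'. (\<forall>j<n. \<sigma>' j = \<sigma> j) \<longrightarrow> K \<sigma>' = K \<sigma>)"

lemma open_cylinder: "open {\<sigma>' :: nat \<Rightarrow> nat. \<forall>j<n. \<sigma>' j = \<sigma> j}"
proof -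
  have "open {\<sigma>' :: nat \<Rightarrow> nat. \<forall>i\<in>{..<n}. \<sigma>' (id i) \<in> {\<sigma> i}}"
   apply (rule product_topology_basis') 
   apply simp
  apply (rule discrete_topology_class.open_discrete)
   done
  then show ?thesis by (simp add: Ball_def)
qed
text \<open>Tychonoff's theorem for a product of finite discrete spaces.\<close>

lemma compact_box: "compact {\<sigma> :: nat \<Rightarrow> nat. \<forall>j. \<sigma> j \<le> m j}"
proof -
  have "compactin (product_topology (\<lambda>i. euclidean) UNIV) (PiE UNIV (\<lambda>j. {..m j}))"
    by (subst compactin_PiE) (auto intro: finite_imp_compact)
  moreover have "PiE UNIV (\<lambda>j. {..m j}) = {\<sigma>. \<forall>j. \<sigma> j \<le> m j}"
    by auto
  ultimately show ?thesis
    by (simp add: euclidean_product_topology)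
qed

lemma locally_const_open_vimage:
  assumes "locally_const K"
  shows "open {\<sigma>. P (K \<sigma>)}"
proof (subst open_subopen, intro ballI)
  fix \<sigma> assume \<sigma>: "\<sigma> \<in> {\<sigma>. P (K \<sigma>)}"
  obtain n where n: "\<And>\<sigma>'. (\<forall>j<n. \<sigma>' j = \<sigma> j) \<Longrightarrow> K \<sigma>' = K \<sigma>"
    using assms[unfolded locally_const_def, rule_format, of \<sigma>] by blast
  have "{\<sigma>'. \<forall>j<n. \<sigma>' j = \<sigma> j} \<subseteq> {\<sigma>. P (K \<sigma>)}"
  proof
    fix \<sigma>' assume "\<sigma>' \<in> {\<sigma>'. \<forall>j<n. \<sigma>' j = \<sigma> j}"
    then have "K \<sigma>' = K \<sigma>" by (intro n) simp
    with \<sigma> show "\<sigma>' \<in> {\<sigma>. P (K \<sigma>)}" by simp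
  qed
  then show "\<exists>T. open T \<and> \<sigma> \<in> T \<and> T \<subseteq> {\<sigma>. P (K \<sigma>)}"
    using open_cylinder[of n \<sigma>]
    by (intro exI[of _ "{\<sigma>'. \<forall>j<n. \<sigma>' j = \<sigma> j}"] conjI) simp_all
qed

lemma locally_const_closed_vimage:
  assumes "locally_const K"
  shows "closed {\<sigma>. P (K \<sigma>)}"
proof -
  have "- {\<sigma>. P (K \<sigma>)} = {\<sigma>. \<not> P (K \<sigma>)}" by auto
  then show ?thesis
    using locally_const_open_vimage[OF assms, of "\<lambda>x. \<not> P x"] by (simp add: closed_def)
qed

lemma closed_box: "closed {\<sigma> :: nat \<Rightarrow> nat. \<forall>j. \<sigma> j \<le> m j}"
proof -
  have "closed {\<sigma> :: nat \<Rightarrow> nat. \<sigma> j \<le> m j}" for j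
    by (rule locally_const_closed_vimage) (auto simp: locally_const_def)
  moreover have "{\<sigma> :: nat \<Rightarrow> nat. \<forall>j. \<sigma> j \<le> m j} = (\<Inter>j. {\<sigma>. \<sigma> j \<le> m j})"
    by auto
  ultimately show ?thesis
    by (simp add: closed_INT)
qed

text \<open>Finitely many cylinders on which \<open>K\<close> is constant cover the compact box, and
  \<open>n\<close> is the largest of their lengths. Only \<open>\<sigma>\<close> has to lie in the
  box: \<open>\<sigma>'\<close> may leave it from entry \<open>n\<close> on, and the later
  truncation of witnesses relies on this.\<close>

lemma locally_const_uniform:
  assumes K: "locally_const K"
  shows "\<exists>n. \<forall>\<sigma> \<sigma>'. (\<forall>j. \<sigma> j \<le> m j) \<longrightarrow> (\<forall>j<n. \<sigma>' j = \<sigma> j) \<longrightarrow> K \<sigma>' = K \<sigma>"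
proof -
  let ?B = "{\<sigma>. \<forall>j. \<sigma> j \<le> m j}"
  from choice[OF K[unfolded locally_const_def]]
  obtain k where "\<forall>\<sigma> \<sigma>'. (\<forall>j<k \<sigma>. \<sigma>' j = \<sigma> j) \<longrightarrow> K \<sigma>' = K \<sigma>"
    by (rule exE)
  then have k: "K \<sigma>' = K \<sigma>" if "\<forall>j<k \<sigma>. \<sigma>' j = \<sigma> j" for \<sigma> \<sigma>'
    using that by blast
  let ?C = "\<lambda>\<sigma>. {\<sigma>'. \<forall>j<k \<sigma>. \<sigma>' j = \<sigma> j}"
  obtain D where D: "D \<subseteq> ?B" "finite D" "?B \<subseteq> (\<Union>\<sigma>\<in>D. ?C \<sigma>)"
  proof (rule compactE_image[OF compact_box])
    show "?B \<subseteq> (\<Union>\<sigma>\<in>?B. ?C \<sigma>)" by auto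
  qed (use open_cylinder in auto)
  define n where "n = Max (insert 0 (k ` D))"
  have n: "k \<tau> \<le> n" if "\<tau> \<in> D" for \<tau>
    unfolding n_def using that D(2) by (intro Max_ge) auto
  show ?thesis
  proof (intro exI[of _ n] allI impI)
    fix \<sigma> \<sigma>' assume \<sigma>: "\<forall>j. \<sigma> j \<le> m j" "\<forall>j<n. \<sigma>' j = \<sigma> j"
    then have "\<sigma> \<in> (\<Union>\<sigma>\<in>D. ?C \<sigma>)"
      using D(3) by blast
    then obtain \<tau> where \<tau>: "\<tau> \<in> D" "\<forall>j<k \<tau>. \<sigma> j = \<tau> j"
      by blast
    with \<sigma> n[OF \<tau>(1)] have "\<forall>j<k \<tau>. \<sigma>' j = \<tau> j" by auto
    then have "K \<sigma>' = K \<tau>" by (rule k)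
    moreover have "K \<sigma> = K \<tau>" using \<tau>(2) by (rule k)
    ultimately show "K \<sigma>' = K \<sigma>" by (rule trans[OF _ sym])
  qed
qed

text \<open>Finitely many entries of the reindexed sequence involve only finitely many entries of
  \<open>\<sigma>\<close>. With a pairing function in \<open>g\<close>, this extracts one of
  countably many sequences coded in \<open>\<sigma>\<close>.\<close>

lemma locally_const_reindex:
  assumes "locally_const K"
  shows "locally_const (\<lambda>\<sigma>. K (\<lambda>j. \<sigma> (g j)))"
  unfolding locally_const_def
proof
  fix \<sigma> :: "nat \<Rightarrow> nat"
  obtain n where n: "\<And>\<sigma>'. (\<forall>j<n. \<sigma>' j = \<sigma> (g j)) \<Longrightarrow> K \<sigma>' = K (\<lambda>j. \<sigma> (g j))"
    using assms[unfolded locally_const_def, rule_format, of "\<lambda>j. \<sigma> (g j)"] by blast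
  \<comment> \<open>For \<open>n = 0\<close> the \<open>Max\<close> of the empty set is unspecified,
    but then there is no \<open>j\<close> to bound.\<close>
  have less: "g j < Suc (Max (g ` {..<n}))" if "j < n" for j
    using that by (simp add: less_Suc_eq_le)
  show "\<exists>n. \<forall>\<sigma>'. (\<forall>j<n. \<sigma>' j = \<sigma> j) \<longrightarrow> K (\<lambda>j. \<sigma>' (g j)) = K (\<lambda>j. \<sigma> (g j))"
  proof (intro exI allI impI)
    fix \<sigma>' assume "\<forall>j<Suc (Max (g ` {..<n})). \<sigma>' j = \<sigma> j"
    then show "K (\<lambda>j. \<sigma>' (g j)) = K (\<lambda>j. \<sigma> (g j))"
      using less by (intro n) simp
  qed
qed

section \<open>Souslin schemes with compact sections\<close>

text \<open>Subsets of \<open>\<Omega> \<times> X\<close> are represented by their sections. \<open>simple_compact\<close> then describes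
  the finite unions of rectangles with a measurable and a compact side.\<close>

definition simple_compact :: "'w measure \<Rightarrow> ('w \<Rightarrow> 'x::topological_space set) \<Rightarrow> bool"
  where "simple_compact M C \<longleftrightarrow> simple_function M C \<and> (\<forall>\<omega>. compact (C \<omega>))"

lemma simple_compact_Int:
  fixes C :: "'w \<Rightarrow> 'x::t2_space set"
  shows "simple_compact M C \<Longrightarrow> simple_compact M D \<Longrightarrow> simple_compact M (\<lambda>\<omega>. C \<omega> \<inter> D \<omega>)"
  unfolding simple_compact_def by (auto intro: simple_function_compose2)

lemma simple_compact_Un:
  "simple_compact M C \<Longrightarrow> simple_compact M D \<Longrightarrow> simple_compact M (\<lambda>\<omega>. C \<omega> \<union> D \<omega>)"
  unfolding simple_compact_def by (auto intro: simple_function_compose2)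

lemma simple_compact_INT_atMost:
  fixes C :: "nat \<Rightarrow> 'w \<Rightarrow> 'x::t2_space set"
  assumes "\<And>i. simple_compact M (C i)"
  shows "simple_compact M (\<lambda>\<omega>. \<Inter>i\<le>n. C i \<omega>)"
proof (induction n)
  case (Suc n)
  then show ?case
    using simple_compact_Int[OF assms[of "Suc n"] Suc] by (simp add: atMost_Suc)
qed (simp add: assms)

lemma simple_compact_UN:
  assumes "finite J" "\<And>i. i \<in> J \<Longrightarrow> simple_compact M (C i)"
  shows "simple_compact M (\<lambda>\<omega>. \<Union>i\<in>J. C i \<omega>)"
  using assms
proof (induction J rule: finite_induct)
  case empty
  then show ?case by (simp add: simple_compact_def)
next
  case (insert i J)
  then show ?case using simple_compact_Un[of M "C i"] by simp
qed

text \<open>Letting \<open>K n \<sigma>\<close> depend on an unspecified finite part of \<open>\<sigma>\<close>, rather than on its first \<open>n\<close>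
  entries, makes countable unions and intersections of schemes mere reindexings.\<close>

definition souslin_scheme ::
  "'w measure \<Rightarrow> (nat \<Rightarrow> (nat \<Rightarrow> nat) \<Rightarrow> 'w \<Rightarrow> 'x::topological_space set) \<Rightarrow> ('w \<Rightarrow> 'x set) \<Rightarrow> bool"
  where "souslin_scheme M K A \<longleftrightarrow>
    (\<forall>n. locally_const (K n)) \<and> (\<forall>n \<sigma>. simple_compact M (K n \<sigma>)) \<and>
    (\<forall>\<omega>\<in>space M. A \<omega> = {x. \<exists>\<sigma>. \<forall>n. x \<in> K n \<sigma> \<omega>})"

lemma souslin_schemeD:
  assumes "souslin_scheme M K A"
  shows "locally_const (K n)" "simple_compact M (K n \<sigma>)"
    "\<omega> \<in> space M \<Longrightarrow> A \<omega> = {x. \<exists>\<sigma>. \<forall>n. x \<in> K n \<sigma> \<omega>}"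
  using assms unfolding souslin_scheme_def by simp_all

lemma souslin_schemeI:
  assumes "\<And>n. locally_const (K n)" "\<And>n \<sigma>. simple_compact M (K n \<sigma>)"
    "\<And>\<omega>. \<omega> \<in> space M \<Longrightarrow> A \<omega> = {x. \<exists>\<sigma>. \<forall>n. x \<in> K n \<sigma> \<omega>}"
  shows "souslin_scheme M K A"
  using assms unfolding souslin_scheme_def by simp

definition souslin_sections :: "'w measure \<Rightarrow> ('w \<Rightarrow> 'x::topological_space set) \<Rightarrow> bool"
  where "souslin_sections M A \<longleftrightarrow> (\<exists>K. souslin_scheme M K A)"

lemma souslin_sections_cong:
  assumes "\<And>\<omega>. \<omega> \<in> space M \<Longrightarrow> A \<omega> = B \<omega>"
  shows "souslin_sections M A \<longleftrightarrow> souslin_sections M B"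
  unfolding souslin_sections_def souslin_scheme_def using assms by simp

lemma souslin_sections_simple_compact:
  assumes "simple_compact M C"
  shows "souslin_sections M C"
  unfolding souslin_sections_def
  by (rule exI[of _ "\<lambda>n \<sigma>. C"]) (simp add: assms locally_const_def souslin_scheme_def)

text \<open>The first entry of \<open>\<sigma>\<close> selects the index \<open>i\<close>, and the
  shifted sequence is a witness for the scheme of \<open>A i\<close>.\<close>

lemma souslin_sections_UN:
  assumes "\<And>i::nat. souslin_sections M (A i)"
  shows "souslin_sections M (\<lambda>\<omega>. \<Union>i. A i \<omega>)"
proof -
  obtain K where "\<And>i. souslin_scheme M (K i) (A i)"
    using assms unfolding souslin_sections_def by metis
  note K = souslin_schemeD[OF this]
  define L where "L n \<sigma> = K (\<sigma> 0) n (\<lambda>j. \<sigma> (Suc j))" for n and \<sigma> :: "nat \<Rightarrow> nat"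
  have "locally_const (L n)" for n
    unfolding locally_const_def
  proof
    fix \<sigma> :: "nat \<Rightarrow> nat"
    obtain k where k: "\<And>\<sigma>'. (\<forall>j<k. \<sigma>' j = \<sigma> (Suc j)) \<Longrightarrow> K (\<sigma> 0) n \<sigma>' = K (\<sigma> 0) n (\<lambda>j. \<sigma> (Suc j))"
      using K(1)[of "\<sigma> 0" n, unfolded locally_const_def, rule_format, of "\<lambda>j. \<sigma> (Suc j)"] by blast
    \<comment> \<open>One entry more than \<open>k\<close>: entry 0 fixes the selected index, the
      others fix the first \<open>k\<close> entries of the shifted sequence.\<close>
    show "\<exists>k. \<forall>\<sigma>'. (\<forall>j<k. \<sigma>' j = \<sigma> j) \<longrightarrow> L n \<sigma>' = L n \<sigma>"
    proof (intro exI[of _ "Suc k"] allI impI)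
      fix \<sigma>' assume \<sigma>': "\<forall>j<Suc k. \<sigma>' j = \<sigma> j"
      then have "K (\<sigma> 0) n (\<lambda>j. \<sigma>' (Suc j)) = K (\<sigma> 0) n (\<lambda>j. \<sigma> (Suc j))"
        by (intro k) simp
      with \<sigma>' show "L n \<sigma>' = L n \<sigma>"
        by (simp add: L_def)
    qed
  qed
  moreover have "simple_compact M (L n \<sigma>)" for n \<sigma>
    unfolding L_def by (rule K)
  moreover have "(\<Union>i. A i \<omega>) = {x. \<exists>\<sigma>. \<forall>n. x \<in> L n \<sigma> \<omega>}" if \<omega>: "\<omega> \<in> space M" for \<omega>
  proof (intro set_eqI iffI)
    fix x assume "x \<in> (\<Union>i. A i \<omega>)"
    then obtain i \<sigma> where "\<forall>n. x \<in> K i n \<sigma> \<omega>"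
      using K(3)[OF \<omega>] by auto
    then have "\<forall>n. x \<in> L n (case_nat i \<sigma>) \<omega>"
      by (simp add: L_def)
    then show "x \<in> {x. \<exists>\<sigma>. \<forall>n. x \<in> L n \<sigma> \<omega>}" by blast
  next
    fix x assume "x \<in> {x. \<exists>\<sigma>. \<forall>n. x \<in> L n \<sigma> \<omega>}"
    then obtain \<sigma> where "\<forall>n. x \<in> L n \<sigma> \<omega>" by blast
    then have "x \<in> A (\<sigma> 0) \<omega>"
      unfolding K(3)[OF \<omega>] L_def by blast
    then show "x \<in> (\<Union>i. A i \<omega>)" by blast
  qed
  ultimately have "souslin_scheme M L (\<lambda>\<omega>. \<Union> i. A i \<omega>)"
    by (rule souslin_schemeI)
  then show ?thesis
    unfolding souslin_sections_def by blast
qed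

text \<open>Through \<open>prod_encode\<close>, one sequence codes a witness for every
  \<open>i\<close>, and the level \<open>p\<close> of \<open>L\<close> codes a pair
  \<open>(i, n)\<close>. A single sequence thus meets the conditions of all schemes at once.\<close>

lemma souslin_sections_INT:
  assumes "\<And>i::nat. souslin_sections M (A i)"
  shows "souslin_sections M (\<lambda>\<omega>. \<Inter>i. A i \<omega>)"
proof -
  obtain K where "\<And>i. souslin_scheme M (K i) (A i)"
    using assms unfolding souslin_sections_def by metis
  note K = souslin_schemeD[OF this]
  define L where "L p \<sigma> = K (fst (prod_decode p)) (snd (prod_decode p))
      (\<lambda>j. \<sigma> (prod_encode (fst (prod_decode p), j)))" for p and \<sigma> :: "nat \<Rightarrow> nat"
  have "locally_const (L p)" for p
    unfolding L_def by (rule locally_const_reindex) (rule K)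
  moreover have "simple_compact M (L p \<sigma>)" for p \<sigma>
    unfolding L_def by (rule K)
  moreover have "(\<Inter>i. A i \<omega>) = {x. \<exists>\<sigma>. \<forall>n. x \<in> L n \<sigma> \<omega>}" if \<omega>: "\<omega> \<in> space M" for \<omega>
  proof (intro set_eqI iffI)
    fix x assume "x \<in> (\<Inter>i. A i \<omega>)"
    then have "\<forall>i. \<exists>\<sigma>. \<forall>n. x \<in> K i n \<sigma> \<omega>"
      using K(3)[OF \<omega>] by auto
    then obtain s where s: "\<And>i n. x \<in> K i n (s i) \<omega>" by metis
    have "\<forall>p. x \<in> L p (\<lambda>q. s (fst (prod_decode q)) (snd (prod_decode q))) \<omega>"
      by (simp add: L_def s)
    then show "x \<in> {x. \<exists>\<sigma>. \<forall>n. x \<in> L n \<sigma> \<omega>}" by blast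
  next
    fix x assume "x \<in> {x. \<exists>\<sigma>. \<forall>n. x \<in> L n \<sigma> \<omega>}"
    then obtain \<sigma> where \<sigma>: "\<And>n. x \<in> L n \<sigma> \<omega>" by blast
    have "x \<in> K i n (\<lambda>j. \<sigma> (prod_encode (i, j))) \<omega>" for i n
      using \<sigma>[of "prod_encode (i, n)"] by (simp add: L_def)
    then show "x \<in> (\<Inter>i. A i \<omega>)"
      unfolding K(3)[OF \<omega>] by blast
  qed
  ultimately have "souslin_scheme M L (\<lambda>\<omega>. \<Inter> i. A i \<omega>)"
    by (rule souslin_schemeI)
  then show ?thesis
    unfolding souslin_sections_def by blast
qed

section \<open>Choquet capacitability and the projection theorem\<close>

text \<open>Outer measure is continuous along increasing sequences, so the entries of \<open>\<sigma>\<close> can be bounded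
  one at a time, by \<open>m\<close>, while the outer measure of the projection stays above \<open>c\<close>. In the
  compact box below \<open>m\<close>, only finitely many \<open>K i \<sigma>\<close> occur for each \<open>i\<close>, and nested compact
  sections let the projection commute with the intersection over \<open>n\<close>.\<close>

lemma souslin_sections_inner_approx:
  fixes A :: "'w \<Rightarrow> 'x::t2_space set"
  assumes "finite_measure M" and A: "souslin_sections M A"
    and c: "c < outer_measure_of M {\<omega>\<in>space M. A \<omega> \<noteq> {}}"
  shows "\<exists>B\<in>sets M. B \<subseteq> {\<omega>\<in>space M. A \<omega> \<noteq> {}} \<and> c \<le> emeasure M B"
proof -
  interpret finite_measure M by fact
  obtain K where "souslin_scheme M K A"
    using A unfolding souslin_sections_def by blast
  note K = souslin_schemeD[OF this]
  \<comment> \<open>These sets interpolate between the full projection, at \<open>k = 0\<close>, and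
    the part whose witnesses have more and more bounded entries. They need not be measurable, hence
    the outer measure.\<close>
  define E where "E k s = {\<omega>\<in>space M. \<exists>x \<sigma>. (\<forall>j<k. \<sigma> j \<le> s j) \<and> (\<forall>n. x \<in> K n \<sigma> \<omega>)}"
    for k and s :: "nat \<Rightarrow> nat"
  have E_I: "\<omega> \<in> E k s" if "\<omega> \<in> space M" "\<forall>j<k. \<sigma> j \<le> s j" "\<forall>n. x \<in> K n \<sigma> \<omega>" for k s \<omega> \<sigma> x
    using that unfolding E_def by blast
  have E_mono: "E k s \<subseteq> E k s'" if "\<And>j. j < k \<Longrightarrow> s j \<le> s' j" for k s s'
  proof
    fix \<omega> assume "\<omega> \<in> E k s"
    then obtain x \<sigma> where "\<omega> \<in> space M" "\<forall>j<k. \<sigma> j \<le> s j" "\<forall>n. x \<in> K n \<sigma> \<omega>"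
      unfolding E_def by blast
    then show "\<omega> \<in> E k s'"
      using that by (intro E_I[of \<omega> k \<sigma> s' x]) (auto intro: le_trans)
  qed
  have E_cong: "E k s = E k s'" if "\<And>j. j < k \<Longrightarrow> s j = s' j" for k s s'
    using E_mono[of k s s'] E_mono[of k s' s] that by simp
  \<comment> \<open>Passing from \<open>k\<close> to \<open>Suc k\<close> chooses a bound for entry
    \<open>k\<close> and keeps the earlier bounds, so each entry of the bound stabilises.\<close>
  have "\<exists>S. \<forall>k. c < outer_measure_of M (E k (S k)) \<and> (\<forall>j<k. S (Suc k) j = S k j)"
  proof (rule dependent_nat_choice)
    have "E 0 (\<lambda>_. 0) = {\<omega>\<in>space M. A \<omega> \<noteq> {}}"
      by (simp add: E_def K(3) cong: conj_cong)
    then show "\<exists>s. c < outer_measure_of M (E 0 s)"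
      using c by metis
  next
    fix s k assume *: "c < outer_measure_of M (E k s)"
    have "E k s = (\<Union>v. E (Suc k) (s(k := v)))"
    proof (intro equalityI subsetI)
      fix \<omega> assume "\<omega> \<in> E k s"
      then obtain x \<sigma> where "\<omega> \<in> space M" "\<forall>j<k. \<sigma> j \<le> s j" "\<forall>n. x \<in> K n \<sigma> \<omega>"
        unfolding E_def by blast
      then have "\<omega> \<in> E (Suc k) (s(k := \<sigma> k))"
        by (intro E_I[of \<omega> "Suc k" \<sigma> _ x]) (simp_all add: less_Suc_eq)
      then show "\<omega> \<in> (\<Union>v. E (Suc k) (s(k := v)))" by blast
    next
      fix \<omega> assume "\<omega> \<in> (\<Union>v. E (Suc k) (s(k := v)))"
      then obtain v x \<sigma> where \<sigma>: "\<omega> \<in> space M" "\<forall>j<Suc k. \<sigma> j \<le> (s(k := v)) j" "\<forall>n. x \<in> K n \<sigma> \<omega>"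
        unfolding E_def by blast
      have "\<sigma> j \<le> s j" if "j < k" for j
        using \<sigma>(2)[rule_format, of j] that by simp
      with \<sigma> show "\<omega> \<in> E k s"
        by (intro E_I[of \<omega> k \<sigma> s x]) blast+
    qed
    moreover have "incseq (\<lambda>v. E (Suc k) (s(k := v)))"
      unfolding incseq_def by (intro allI impI E_mono) simp
    ultimately have "outer_measure_of M (E k s) = (SUP v. outer_measure_of M (E (Suc k) (s(k := v))))"
      by (subst SUP_outer_measure_of_incseq) (auto simp: E_def)
    with * obtain v where "c < outer_measure_of M (E (Suc k) (s(k := v)))"
      by (auto simp: less_SUP_iff)
    then show "\<exists>s'. c < outer_measure_of M (E (Suc k) s') \<and> (\<forall>j<k. s' j = s j)"
      by (intro exI[of _ "s(k := v)"]) auto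
  qed
  then obtain S where S: "\<And>k. c < outer_measure_of M (E k (S k))"
      "\<And>k j. j < k \<Longrightarrow> S (Suc k) j = S k j"
    by blast
  \<comment> \<open>The stable values of the bounds: entry \<open>j\<close> no longer changes from
    stage \<open>Suc j\<close> on.\<close>
  define m where "m j = S (Suc j) j" for j
  have S_eq: "S (Suc j + d) j = m j" for j d
    by (induction d) (auto simp: m_def S(2))
  have S_m: "S k j = m j" if "j < k" for k j
    using S_eq[of j "k - Suc j"] that by simp
  have E_m: "c < outer_measure_of M (E k m)" for k
    using S(1)[of k] E_cong[of k "S k" m] S_m by simp
  \<comment> \<open>Here the whole witness is bounded, but it only has to meet the conditions up to
    \<open>n\<close> and may therefore change with \<open>n\<close>.\<close>
  define B where "B n \<omega> = {x. \<exists>\<sigma>. (\<forall>j. \<sigma> j \<le> m j) \<and> (\<forall>i\<le>n. x \<in> K i \<sigma> \<omega>)}" for n \<omega>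
  have B: "simple_compact M (B n) \<and> (\<exists>k. E k m \<subseteq> {\<omega>\<in>space M. B n \<omega> \<noteq> {}})" for n :: nat
  proof -
    have "\<forall>i. \<exists>k. \<forall>\<sigma> \<sigma>'. (\<forall>j. \<sigma> j \<le> m j) \<longrightarrow> (\<forall>j<k. \<sigma>' j = \<sigma> j) \<longrightarrow> K i \<sigma>' = K i \<sigma>"
      using locally_const_uniform[OF K(1)] by blast
    then obtain k where k: "\<And>i \<sigma> \<sigma>'. (\<forall>j. \<sigma> j \<le> m j) \<Longrightarrow> (\<forall>j<k i. \<sigma>' j = \<sigma> j) \<Longrightarrow> K i \<sigma>' = K i \<sigma>"
      by metis
    define N where "N = Max (k ` {..n})"
    have k_le: "k i \<le> N" if "i \<le> n" for i
      unfolding N_def using that by (intro Max_ge) auto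
    have N: "K i \<sigma>' = K i \<sigma>" if "i \<le> n" "\<forall>j. \<sigma> j \<le> m j" "\<forall>j<N. \<sigma>' j = \<sigma> j" for i \<sigma> \<sigma>'
      using less_le_trans[OF _ k_le[OF that(1)]] that(3) by (intro k[OF that(2)]) blast
    \<comment> \<open>Filling up with 0 stays below \<open>m\<close>, and \<open>N\<close> entries
      determine \<open>K i\<close> for \<open>i \<le> n\<close>. The finite set \<open>J\<close> of
      truncated sequences can therefore replace the whole box.\<close>
    define T where "T \<sigma> = (\<lambda>j. if j < N then \<sigma> j else 0)" for \<sigma> :: "nat \<Rightarrow> nat"
    define J where "J = T ` (PiE {..<N} (\<lambda>j. {..m j}))"
    have "finite J"
      unfolding J_def by (intro finite_imageI finite_PiE) auto
    have JB: "\<forall>j. \<sigma> j \<le> m j" if \<sigma>: "\<sigma> \<in> J" for \<sigma>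
    proof
      fix j
      obtain s where "\<sigma> = T s" "s \<in> PiE {..<N} (\<lambda>j. {..m j})"
        using \<sigma> unfolding J_def by blast
      then show "\<sigma> j \<le> m j"
        using PiE_mem[of s "{..<N}" "\<lambda>j. {..m j}" j] by (simp add: T_def)
    qed
    have TJ: "T \<sigma> \<in> J" if "\<forall>j<N. \<sigma> j \<le> m j" for \<sigma>
      unfolding J_def
    proof (rule image_eqI)
      show "T \<sigma> = T (restrict \<sigma> {..<N})"
        by (simp add: T_def cong: if_cong)
      show "restrict \<sigma> {..<N} \<in> PiE {..<N} (\<lambda>j. {..m j})"
        using that by (simp add: restrict_PiE_iff)
    qed
    have KT: "K i (T \<sigma>) = K i \<sigma>" if "i \<le> n" "\<forall>j<N. \<sigma> j \<le> m j" for i \<sigma>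
      using that JB[OF TJ[OF that(2)]] by (intro N[symmetric]) (simp_all add: T_def)
    have "B n = (\<lambda>\<omega>. \<Union>\<sigma>\<in>J. \<Inter>i\<le>n. K i \<sigma> \<omega>)"
    proof (rule ext, intro set_eqI iffI)
      fix \<omega> x assume "x \<in> B n \<omega>"
      then obtain \<sigma> where \<sigma>: "\<forall>j. \<sigma> j \<le> m j" "\<forall>i\<le>n. x \<in> K i \<sigma> \<omega>"
        unfolding B_def by blast
      have "T \<sigma> \<in> J"
        using \<sigma>(1) by (intro TJ) simp
      moreover have "x \<in> K i (T \<sigma>) \<omega>" if "i \<le> n" for i
        using \<sigma> that KT[of i \<sigma>] by simp
      ultimately show "x \<in> (\<Union>\<sigma>\<in>J. \<Inter>i\<le>n. K i \<sigma> \<omega>)" by blast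
    next
      fix \<omega> x assume "x \<in> (\<Union>\<sigma>\<in>J. \<Inter>i\<le>n. K i \<sigma> \<omega>)"
      then show "x \<in> B n \<omega>"
        unfolding B_def using JB by blast
    qed
    moreover have "simple_compact M (\<lambda>\<omega>. \<Union>\<sigma>\<in>J. \<Inter>i\<le>n. K i \<sigma> \<omega>)"
      using \<open>finite J\<close> by (intro simple_compact_UN simple_compact_INT_atMost K)
    \<comment> \<open>A witness for \<open>E N m\<close> is bounded only on its first
      \<open>N\<close> entries; its truncation lies in the box and still meets the conditions up to
      \<open>n\<close>.\<close>
    moreover have "E N m \<subseteq> {\<omega>\<in>space M. B n \<omega> \<noteq> {}}"
    proof
      fix \<omega> assume "\<omega> \<in> E N m"
      then obtain x \<sigma> where "\<omega> \<in> space M" "\<forall>j<N. \<sigma> j \<le> m j" "\<And>n. x \<in> K n \<sigma> \<omega>"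
        unfolding E_def by blast
      moreover from this have "x \<in> K i (T \<sigma>) \<omega>" if "i \<le> n" for i
        using that KT[of i \<sigma>] by simp
      ultimately have "\<omega> \<in> space M" "x \<in> B n \<omega>"
        unfolding B_def using JB[OF TJ[of \<sigma>]] by blast+
      then show "\<omega> \<in> {\<omega>\<in>space M. B n \<omega> \<noteq> {}}" by blast
    qed
    ultimately show ?thesis by auto
  qed
  define P where "P n = {\<omega>\<in>space M. B n \<omega> \<noteq> {}}" for n
  have P_sets: "P n \<in> sets M" for n
  proof -
    have "P n = B n -` (- {{}}) \<inter> space M"
      by (auto simp: P_def)
    then show ?thesis
      using B[of n] simple_functionD(2)[of M "B n"] by (simp add: simple_compact_def)
  qed
  have P_ge: "c \<le> emeasure M (P n)" for n
  proof -
    obtain k where "E k m \<subseteq> P n"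
      using B[of n] P_def by auto
    then have "outer_measure_of M (E k m) \<le> outer_measure_of M (P n)"
      by (rule outer_measure_of_mono)
    then show ?thesis
      using E_m[of k] P_sets by simp
  qed
  have B_Suc: "B (Suc n) \<omega> \<subseteq> B n \<omega>" for n \<omega>
    unfolding B_def using le_SucI by blast
  then have "decseq P"
    unfolding decseq_Suc_iff P_def by blast
  then have "emeasure M (\<Inter>n. P n) = (INF n. emeasure M (P n))"
    using P_sets by (intro INF_emeasure_decseq[symmetric]) auto
  then have "c \<le> emeasure M (\<Inter>n. P n)"
    using P_ge by (simp add: INF_greatest)
  moreover have "(\<Inter>n. P n) \<in> sets M"
    using P_sets by blast
  moreover have "(\<Inter>n. P n) \<subseteq> {\<omega>\<in>space M. A \<omega> \<noteq> {}}"
  proof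
    fix \<omega> assume \<omega>: "\<omega> \<in> (\<Inter>n. P n)"
    \<comment> \<open>Compactness in the fibre yields one point \<open>x\<close> in all
      \<open>B n \<omega>\<close>, with a witness that still depends on \<open>n\<close>.\<close>
    have "(\<Inter>n. B n \<omega>) \<noteq> {}"
      using \<omega> B B_Suc
      by (intro compact_decseq_Inter_nonempty) (auto simp: simple_compact_def P_def compact_imp_closed)
    then obtain x where x: "\<And>n. x \<in> B n \<omega>" by blast
    \<comment> \<open>Compactness in the box of sequences: \<open>Q n\<close> collects the witnesses
      for \<open>x\<close> up to level \<open>n\<close>, and a common element serves all
      levels.\<close>
    define Q where "Q n = {\<sigma>. \<forall>j. \<sigma> j \<le> m j} \<inter> (\<Inter>i\<le>n. {\<sigma>. x \<in> K i \<sigma> \<omega>})" for n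
    have closed: "closed {\<sigma>. x \<in> K i \<sigma> \<omega>}" for i
      by (rule locally_const_closed_vimage[OF K(1)])
    have "(\<Inter>n. Q n) \<noteq> {}"
    proof (rule compact_decseq_Inter_nonempty)
      show "compact (Q 0)"
        unfolding Q_def by (intro compact_Int_closed compact_box closed_INT ballI closed)
      show "closed (Q n)" for n
        unfolding Q_def by (intro closed_Int closed_INT ballI closed closed_box)
      show "Q n \<noteq> {}" for n
        using x[of n] unfolding Q_def B_def by blast
      show "Q (Suc n) \<subseteq> Q n" for n
        unfolding Q_def using le_SucI by blast
    qed
    then obtain \<sigma> where "\<And>n. \<sigma> \<in> Q n" by blast
    then have "\<forall>n. x \<in> K n \<sigma> \<omega>" by (auto simp: Q_def)
    then show "\<omega> \<in> {\<omega>\<in>space M. A \<omega> \<noteq> {}}"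
      using \<omega> K(3) by (auto simp: P_def)
  qed
  ultimately show ?thesis by blast
qed

text \<open>Measurable sets inside the projection approach its outer measure. Hence a measurable
  hull \<open>G\<close> and a countable union \<open>H\<close> of inner sets have equal measure, and
  the projection, lying between them, differs from \<open>H\<close> by a subset of a null
  set.\<close>

lemma souslin_sections_projection:
  fixes A :: "'w \<Rightarrow> 'x::t2_space set"
  assumes "finite_measure M" and A: "souslin_sections M A"
  shows "{\<omega>\<in>space M. A \<omega> \<noteq> {}} \<in> sets (completion M)"
proof -
  interpret finite_measure M by fact
  let ?E = "{\<omega>\<in>space M. A \<omega> \<noteq> {}}"
  obtain G where G: "G \<in> sets M" "?E \<subseteq> G" "outer_measure_of M ?E = emeasure M G"
    using outer_measure_of_attain[of ?E M] by auto
  define \<F> where "\<F> = {B\<in>sets M. B \<subseteq> ?E}"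
  have "\<F> \<noteq> {}" by (auto simp: \<F>_def)
  then obtain b :: "nat \<Rightarrow> ennreal" where b: "range b \<subseteq> emeasure M ` \<F>" "(SUP B\<in>\<F>. emeasure M B) = (SUP n. b n)"
    using ennreal_Sup_countable_SUP[of "emeasure M ` \<F>"] by auto
  then have "\<forall>n. \<exists>B\<in>\<F>. b n = emeasure M B" by blast
  then obtain B where B: "\<And>n::nat. B n \<in> \<F>" "\<And>n. b n = emeasure M (B n)" by metis
  define H where "H = (\<Union>n. B n)"
  have H: "H \<in> sets M" "H \<subseteq> ?E"
    using B(1) by (auto simp: H_def \<F>_def)
  have "emeasure M G \<le> emeasure M H"
  proof (rule dense_le)
    fix c assume "c < emeasure M G"
    then obtain B' where B': "B' \<in> \<F>" "c \<le> emeasure M B'"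
      using souslin_sections_inner_approx[OF assms, of c] G(3) by (auto simp: \<F>_def)
    note B'(2)
    also have "emeasure M B' \<le> (SUP B\<in>\<F>. emeasure M B)"
      using B'(1) by (rule SUP_upper)
    also have "\<dots> = (SUP n. emeasure M (B n))"
      using b(2) B(2) by simp
    also have "\<dots> \<le> emeasure M H"
      using B(1) H(1) by (intro SUP_least emeasure_mono) (auto simp: H_def)
    finally show "c \<le> emeasure M H" .
  qed
  moreover have "emeasure M (G - H) = emeasure M G - emeasure M H"
    using H G by (intro emeasure_Diff) auto
  ultimately have "G - H \<in> null_sets M"
    using G(1) H(1) by (intro null_setsI) (simp_all add: diff_eq_0_iff_ennreal less_top[symmetric])
  then have "?E = H \<union> (?E - H)" "?E - H \<subseteq> G - H"
    using H G by auto
  then show ?thesis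
    using H(1) \<open>G - H \<in> null_sets M\<close> by (intro sets_completionI[of ?E H "?E - H" "G - H"])
qed

section \<open>Souslin sections of product measurable sets\<close>

lemma souslin_sections_Un:
  assumes "souslin_sections M A" "souslin_sections M B"
  shows "souslin_sections M (\<lambda>\<omega>. A \<omega> \<union> B \<omega>)"
proof -
  have "souslin_sections M (\<lambda>\<omega>. \<Union>i. (if i = (0::nat) then A else B) \<omega>)"
    by (rule souslin_sections_UN) (simp add: assms)
  moreover have "(\<Union>i. (if i = (0::nat) then A else B) \<omega>) = A \<omega> \<union> B \<omega>" for \<omega>
    by (auto split: if_splits)
  ultimately show ?thesis by simp
qed

lemma souslin_sections_Int:
  assumes "souslin_sections M A" "souslin_sections M B"
  shows "souslin_sections M (\<lambda>\<omega>. A \<omega> \<inter> B \<omega>)"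
proof -
  have "souslin_sections M (\<lambda>\<omega>. \<Inter>i. (if i = (0::nat) then A else B) \<omega>)"
    by (rule souslin_sections_INT) (simp add: assms)
  moreover have "(\<Inter>i. (if i = (0::nat) then A else B) \<omega>) = A \<omega> \<inter> B \<omega>" for \<omega>
    by (auto split: if_splits)
  ultimately show ?thesis by simp
qed

lemma souslin_sections_If_compact:
  assumes "a \<in> sets M" "compact C" "compact D"
  shows "souslin_sections M (\<lambda>\<omega>. if \<omega> \<in> a then C else D)"
proof (rule souslin_sections_simple_compact)
  have "simple_function M (\<lambda>\<omega>. if \<omega> \<in> a then C else D)"
    using sets.sets_into_space[OF assms(1)]
    by (intro simple_function_If_set simple_function_const) (simp add: Int_absorb2 assms(1))
  then show "simple_compact M (\<lambda>\<omega>. if \<omega> \<in> a then C else D)"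
    using assms by (simp add: simple_compact_def)
qed

lemma souslin_sections_const_compact:
  "compact C \<Longrightarrow> souslin_sections M (\<lambda>\<omega>. C)"
  using souslin_sections_If_compact[of "space M" M C C] by simp

text \<open>\<open>C k\<close> consists of the points of \<open>X\<close> at distance at least
  \<open>1 / (k + 1)\<close> from the complement of \<open>U\<close>. If that complement is empty,
  the intersection is the whole space and \<open>C k = X\<close>.\<close>

lemma compact_Int_open_eq_UN_compact:
  fixes X :: "'x::metric_space set"
  assumes "compact X" "open U"
  obtains C :: "nat \<Rightarrow> 'x set" where "\<And>k. compact (C k)" "X \<inter> U = (\<Union>k. C k)"
proof
  define C where "C k = X \<inter> (\<Inter>y\<in>-U. {x. 1 / real (Suc k) \<le> dist x y})" for k
  show "compact (C k)" for k
    unfolding C_def by (intro compact_Int_closed assms closed_INT ballI closed_Collect_le continuous_intros)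
  show "X \<inter> U = (\<Union>k. C k)"
  proof (intro equalityI subsetI)
    fix x assume x: "x \<in> X \<inter> U"
    then obtain e where e: "e > 0" "\<And>y. dist y x < e \<Longrightarrow> y \<in> U"
      using \<open>open U\<close> unfolding open_dist by blast
    obtain k where k: "1 / real (Suc k) < e"
      using reals_Archimedean[OF e(1)] by (auto simp: inverse_eq_divide)
    have "1 / real (Suc k) \<le> dist x y" if "y \<notin> U" for y
      using e(2)[of y] that k by (cases "dist y x < e") (auto simp: dist_commute)
    with x have "x \<in> C k" by (auto simp: C_def)
    then show "x \<in> (\<Union>k. C k)" by blast
  next
    fix x assume "x \<in> (\<Union>k. C k)"
    then obtain k where k: "x \<in> C k" by blast
    have "x \<in> U"
    proof (rule ccontr)
      assume "x \<notin> U"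
      with k have "1 / real (Suc k) \<le> dist x x"
        unfolding C_def by blast
      then show False by (simp add: field_simps)
    qed
    with k show "x \<in> X \<inter> U" by (simp add: C_def)
  qed
qed

text \<open>Souslin sets are not closed under complements in general, so the induction over Borel
  sets carries \<open>b\<close> and its complement together: complementation swaps the two claims,
  and a union needs closure under both countable unions and countable intersections.\<close>

lemma souslin_sections_const_borel:
  fixes X :: "'x::metric_space set"
  assumes X: "compact X" and "b \<in> sets borel"
  shows "souslin_sections M (\<lambda>\<omega>. X \<inter> b) \<and> souslin_sections M (\<lambda>\<omega>. X - b)"
proof -
  have "b \<in> sigma_sets UNIV {S. open S}"
    using assms by (simp add: sets_borel)
  then show ?thesis
  proof induction
    case (Basic U)
    then obtain C :: "nat \<Rightarrow> 'x set" where C: "\<And>k. compact (C k)" "X \<inter> U = (\<Union>k. C k)"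
      using compact_Int_open_eq_UN_compact[OF X, of U] by auto
    have "souslin_sections M (\<lambda>\<omega>. X \<inter> U)"
      unfolding C(2) by (intro souslin_sections_UN souslin_sections_const_compact C)
    moreover have "compact (X - U)"
      using X Basic by (simp add: compact_diff)
    ultimately show ?case
      by (simp add: souslin_sections_const_compact)
  next
    case Empty
    then show ?case
      using X by (simp add: souslin_sections_const_compact)
  next
    case (Compl b)
    moreover have "X \<inter> (UNIV - b) = X - b" "X - (UNIV - b) = X \<inter> b"
      by auto
    ultimately show ?case by simp
  next
    case (Union b)
    have eq: "X \<inter> (\<Union>i. b i) = (\<Union>i. X \<inter> b i)" "X - (\<Union>i. b i) = (\<Inter>i. X - b i)"
      by auto
    show ?case
      unfolding eq by (intro conjI souslin_sections_UN souslin_sections_INT; simp add: Union)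
  qed
qed

text \<open>The same paired induction, started at rectangles, whose sections and complements of
  sections are built from a compact-valued simple map and a constant Borel set.\<close>

lemma souslin_sections_pair_measure:
  fixes X :: "'x::metric_space set"
  assumes X: "compact X" and A: "A \<in> sets (M \<Otimes>\<^sub>M restrict_space borel X)"
  shows "souslin_sections M (\<lambda>\<omega>. Pair \<omega> -` A)"
proof -
  let ?R = "{a \<times> b | a b. a \<in> sets M \<and> b \<in> sets (restrict_space borel X)}"
  have sub: "?R \<subseteq> Pow (space M \<times> X)"
    using sets.sets_into_space[of _ M] sets.sets_into_space[of _ "restrict_space borel X"]
    by (fastforce simp: space_restrict_space)
  have "A \<in> sigma_sets (space M \<times> X) ?R"
    using A by (simp add: sets_pair_measure space_restrict_space)
  then have "souslin_sections M (\<lambda>\<omega>. Pair \<omega> -` A) \<and> souslin_sections M (\<lambda>\<omega>. X - Pair \<omega> -` A)"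
  proof induction
    case (Basic R)
    then obtain a b where ab: "R = a \<times> (X \<inter> b)" "a \<in> sets M" "b \<in> sets borel"
      by (auto simp: sets_restrict_space)
    have eq: "Pair \<omega> -` R = (if \<omega> \<in> a then X else {}) \<inter> (X \<inter> b)"
      "X - Pair \<omega> -` R = (if \<omega> \<in> a then {} else X) \<union> (X - b)" for \<omega>
      by (auto simp: ab(1))
    note b = souslin_sections_const_borel[OF X ab(3), of M]
    have "souslin_sections M (\<lambda>\<omega>. Pair \<omega> -` R)"
      unfolding eq(1) using b X ab(2)
      by (intro souslin_sections_Int[OF souslin_sections_If_compact]) simp_all
    moreover have "souslin_sections M (\<lambda>\<omega>. X - Pair \<omega> -` R)"
      unfolding eq(2) using b X ab(2)
      by (intro souslin_sections_Un[OF souslin_sections_If_compact]) simp_all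
    ultimately show ?case ..
  next
    case Empty
    then show ?case
      using X by (simp add: souslin_sections_const_compact)
  next
    case (Compl R)
    have "R \<subseteq> space M \<times> X"
      using Compl.hyps sub by (rule sigma_sets_into_sp[rotated])
    \<comment> \<open>Outside \<open>space M\<close> both \<open>R\<close> and its complement have
      empty sections, so complements of sections are compared only over the space.\<close>
    then have eq: "Pair \<omega> -` (space M \<times> X - R) = X - Pair \<omega> -` R"
      "X - Pair \<omega> -` (space M \<times> X - R) = Pair \<omega> -` R" if "\<omega> \<in> space M" for \<omega>
      using that by auto
    have "souslin_sections M (\<lambda>\<omega>. Pair \<omega> -` (space M \<times> X - R)) = souslin_sections M (\<lambda>\<omega>. X - Pair \<omega> -` R)"
      "souslin_sections M (\<lambda>\<omega>. X - Pair \<omega> -` (space M \<times> X - R)) = souslin_sections M (\<lambda>\<omega>. Pair \<omega> -` R)"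
      by (intro souslin_sections_cong eq; assumption)+
    then show ?case
      using Compl.IH by blast
  next
    case (Union R)
    have eq: "Pair \<omega> -` (\<Union>i. R i) = (\<Union>i. Pair \<omega> -` R i)"
      "X - Pair \<omega> -` (\<Union>i. R i) = (\<Inter>i. X - Pair \<omega> -` R i)" for \<omega>
      by auto
    have "souslin_sections M (\<lambda>\<omega>. Pair \<omega> -` (\<Union>i. R i))"
      unfolding eq(1) by (rule souslin_sections_UN) (simp add: Union)
    moreover have "souslin_sections M (\<lambda>\<omega>. X - Pair \<omega> -` (\<Union>i. R i))"
      unfolding eq(2) by (rule souslin_sections_INT) (simp add: Union)
    ultimately show ?case ..
  qed
  then show ?thesis ..
qed

lemma measurable_projection:
  fixes X :: "'x::metric_space set"
  assumes "finite_measure M" and X: "compact X" and A: "A \<in> sets (M \<Otimes>\<^sub>M restrict_space borel X)"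
  shows "fst ` A \<in> sets (completion M)"
proof -
  have "A \<subseteq> space M \<times> X"
    using sets.sets_into_space[OF A] by (simp add: space_pair_measure space_restrict_space)
  then have "fst ` A = {\<omega>\<in>space M. Pair \<omega> -` A \<noteq> {}}"
    by (force simp: image_iff)
  then show ?thesis
    using souslin_sections_projection[OF assms(1) souslin_sections_pair_measure[OF X A]] by simp
qed

section \<open>Maximal ergodic inequality and averages\<close>

lemma measurable_funpow:
  assumes "T \<in> measurable M M"
  shows "T ^^ n \<in> measurable M M"
proof (induction n)
  case (Suc n)
  show ?case
    unfolding funpow.simps by (rule measurable_comp[OF Suc assms])
qed (simp add: id_def)

lemma distr_funpow:
  assumes T: "T \<in> measurable M M" and "distr M M T = M"
  shows "distr M M (T ^^ n) = M"
proof (induction n)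
  case (Suc n)
  have "distr M M (T \<circ> T ^^ n) = distr (distr M M (T ^^ n)) M T"
    by (rule distr_distr[OF T measurable_funpow[OF T], symmetric])
  also have "\<dots> = M"
    by (simp only: Suc assms)
  finally show ?case
    by (simp only: funpow.simps)
qed (simp add: id_def distr_id)

text \<open>The maximum of the Birkhoff sums of \<open>h\<close> of lengths 0 to \<open>n\<close>.
  The recursive form relates the values at \<open>\<omega>\<close> and \<open>T \<omega>\<close>
  directly.\<close>

primrec max_birkhoff_sum :: "('w \<Rightarrow> 'w) \<Rightarrow> ('w \<Rightarrow> real) \<Rightarrow> nat \<Rightarrow> 'w \<Rightarrow> real"
where
  "max_birkhoff_sum T h 0 \<omega> = 0"
| "max_birkhoff_sum T h (Suc n) \<omega> = max 0 (h \<omega> + max_birkhoff_sum T h n (T \<omega>))"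

lemma max_birkhoff_sum_nonneg: "0 \<le> max_birkhoff_sum T h n \<omega>"
  by (cases n) auto

lemma max_birkhoff_sum_mono_Suc:
  "max_birkhoff_sum T h n \<omega> \<le> max_birkhoff_sum T h (Suc n) \<omega>"
proof (induction n arbitrary: \<omega>)
  case (Suc n)
  then have "max_birkhoff_sum T h n (T \<omega>) \<le> max_birkhoff_sum T h (Suc n) (T \<omega>)" .
  then show ?case
    unfolding max_birkhoff_sum.simps(2)[of T h n \<omega>] max_birkhoff_sum.simps(2)[of T h "Suc n" \<omega>]
    by linarith
qed simp

lemma birkhoff_sum_le_max:
  "(\<Sum>i<n. h ((T ^^ i) \<omega>)) \<le> max_birkhoff_sum T h n \<omega>"
proof (induction n arbitrary: \<omega>)
  case (Suc n)
  have "(\<Sum>i<Suc n. h ((T ^^ i) \<omega>)) = h \<omega> + (\<Sum>i<n. h ((T ^^ i) (T \<omega>)))"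
    by (subst sum.lessThan_Suc_shift) (simp add: funpow_swap1)
  with Suc[of "T \<omega>"] show ?case by simp
qed simp

lemma integrable_max_birkhoff_sum:
  assumes T: "T \<in> measurable M M" "distr M M T = M" and h: "integrable M h"
  shows "integrable M (max_birkhoff_sum T h n)"
proof (induction n)
  case (Suc n)
  have "integrable M (\<lambda>\<omega>. max_birkhoff_sum T h n (T \<omega>))"
    using T Suc by (intro integrable_distr[of T M M]) simp_all
  then have "integrable M (\<lambda>\<omega>. max 0 (h \<omega> + max_birkhoff_sum T h n (T \<omega>)))"
    using h by (intro Bochner_Integration.integrable_max Bochner_Integration.integrable_add) simp_all
  then show ?case by (simp add: fun_eq_iff[symmetric] cong: integrable_cong)
qed simp

text \<open>Garsia's argument: where the maximal sum \<open>m\<close> is positive, \<open>h \<ge> m - m \<circ> T\<close>,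
  and elsewhere \<open>m - m \<circ> T \<le> 0\<close>.\<close>

lemma maximal_ergodic:
  assumes T: "T \<in> measurable M M" "distr M M T = M" and h: "integrable M h"
  shows "0 \<le> (\<integral>\<omega>. indicator {\<omega>\<in>space M. 0 < max_birkhoff_sum T h n \<omega>} \<omega> * h \<omega> \<partial>M)"
proof -
  let ?m = "max_birkhoff_sum T h n"
  have int: "integrable M ?m"
    by (rule integrable_max_birkhoff_sum[OF assms])
  then have int_T: "integrable M (\<lambda>\<omega>. ?m (T \<omega>))"
    using T by (intro integrable_distr[of T M M]) simp_all
  have [measurable]: "?m \<in> borel_measurable M"
    using int by simp
  have "(\<integral>\<omega>. ?m (T \<omega>) \<partial>M) = (\<integral>\<omega>. ?m \<omega> \<partial>M)"
    using integral_distr[of T M M ?m] T by simp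
  then have "0 = (\<integral>\<omega>. ?m \<omega> - ?m (T \<omega>) \<partial>M)"
    using int int_T by simp
  also have "\<dots> \<le> (\<integral>\<omega>. indicator {\<omega>\<in>space M. 0 < ?m \<omega>} \<omega> * h \<omega> \<partial>M)"
  proof (intro integral_mono)
    show "integrable M (\<lambda>\<omega>. ?m \<omega> - ?m (T \<omega>))"
      using int int_T by simp
    show "integrable M (\<lambda>\<omega>. indicator {\<omega>\<in>space M. 0 < ?m \<omega>} \<omega> * h \<omega>)"
      using h by (intro integrable_real_mult_indicator[OF _ h, unfolded mult.commute[of "h _"]]) simp
    fix \<omega> assume "\<omega> \<in> space M"
    show "?m \<omega> - ?m (T \<omega>) \<le> indicator {\<omega>\<in>space M. 0 < ?m \<omega>} \<omega> * h \<omega>"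
    proof (cases "0 < ?m \<omega>")
      case True
      then obtain k where k: "n = Suc k" by (cases n) auto
      have "?m \<omega> = h \<omega> + max_birkhoff_sum T h k (T \<omega>)"
        using True unfolding k by (simp add: max_def split: if_splits)
      also have "\<dots> \<le> h \<omega> + ?m (T \<omega>)"
        unfolding k using max_birkhoff_sum_mono_Suc[of T h k "T \<omega>"] by simp
      finally show ?thesis
        using True \<open>\<omega> \<in> space M\<close> by simp
    next
      case False
      then show ?thesis
        using max_birkhoff_sum_nonneg[of T h n "T \<omega>"] by simp
    qed
  qed
  finally show ?thesis .
qed

text \<open>For \<open>h = g - c\<close> the maximal lemma gives
  \<open>c * prob (V n) \<le> expectation g\<close>, as \<open>g\<close> is almost everywhere
  nonnegative off \<open>V n\<close>. The sets \<open>V n\<close> increase to a set containing the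
  event.\<close>

lemma (in prob_space) maximal_ergodic_inequality:
  assumes T: "T \<in> measurable M M" "distr M M T = M"
    and g: "integrable M g" "AE \<omega> in M. 0 \<le> g \<omega>" and c: "0 < c"
  shows "prob {\<omega>\<in>space M. \<exists>n. real n * c < (\<Sum>i<n. g ((T ^^ i) \<omega>))} \<le> expectation g / c"
proof -
  define h where "h \<omega> = g \<omega> - c" for \<omega>
  have h: "integrable M h"
    unfolding h_def using g by simp
  define V where "V n = {\<omega>\<in>space M. 0 < max_birkhoff_sum T h n \<omega>}" for n
  have [measurable]: "max_birkhoff_sum T h n \<in> borel_measurable M" for n
    using integrable_max_birkhoff_sum[OF T h] by simp
  have V[measurable]: "V n \<in> sets M" for n
    unfolding V_def by measurable
  have V_le: "prob (V n) \<le> expectation g / c" for n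
  proof -
    have int: "integrable M (\<lambda>\<omega>. indicator (V n) \<omega> * g \<omega>)" "integrable M (\<lambda>\<omega>. indicator (V n) \<omega> * c)"
      using integrable_real_mult_indicator[OF V g(1)] V by (simp_all add: mult.commute less_top[symmetric])
    have "0 \<le> (\<integral>\<omega>. indicator (V n) \<omega> * h \<omega> \<partial>M)"
      using maximal_ergodic[OF T h, of n] by (simp add: V_def)
    also have "\<dots> = (\<integral>\<omega>. indicator (V n) \<omega> * g \<omega> - indicator (V n) \<omega> * c \<partial>M)"
      by (simp add: h_def right_diff_distrib)
    also have "\<dots> = (\<integral>\<omega>. indicator (V n) \<omega> * g \<omega> \<partial>M) - c * prob (V n)"
      using int V by (simp add: Int_absorb2[OF sets.sets_into_space])
    also have "(\<integral>\<omega>. indicator (V n) \<omega> * g \<omega> \<partial>M) \<le> expectation g"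
      using int g by (intro integral_mono_AE) (auto simp: indicator_def)
    finally show ?thesis
      using c by (simp add: field_simps)
  qed
  have "incseq V"
    unfolding incseq_Suc_iff V_def using max_birkhoff_sum_mono_Suc[of T h] less_le_trans by blast
  then have "(\<lambda>n. prob (V n)) \<longlonglongrightarrow> prob (\<Union>n. V n)"
    using V by (intro finite_Lim_measure_incseq) auto
  then have "prob (\<Union>n. V n) \<le> expectation g / c"
    using V_le by (intro LIMSEQ_le_const2) auto
  moreover have "prob {\<omega>\<in>space M. \<exists>n. real n * c < (\<Sum>i<n. g ((T ^^ i) \<omega>))} \<le> prob (\<Union>n. V n)"
  proof (rule finite_measure_mono)
    show "{\<omega>\<in>space M. \<exists>n. real n * c < (\<Sum>i<n. g ((T ^^ i) \<omega>))} \<subseteq> (\<Union>n. V n)"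
    proof
      fix \<omega> assume "\<omega> \<in> {\<omega>\<in>space M. \<exists>n. real n * c < (\<Sum>i<n. g ((T ^^ i) \<omega>))}"
      then obtain n where \<omega>: "\<omega> \<in> space M" and "real n * c < (\<Sum>i<n. g ((T ^^ i) \<omega>))"
        by blast
      then have "0 < (\<Sum>i<n. h ((T ^^ i) \<omega>))"
        by (simp add: h_def sum_subtractf)
      then have "\<omega> \<in> V n"
        using birkhoff_sum_le_max[of h T \<omega> n] \<omega> by (simp add: V_def)
      then show "\<omega> \<in> (\<Union>n. V n)" by blast
    qed
  qed auto
  ultimately show ?thesis by linarith
qed

section \<open>Limits of averages and limits of expectations\<close>

text \<open>The functions \<open>D n\<close> need not be measurable; \<open>g n\<close> are measurable versions.\<close>

lemma (in prob_space) AE_average_tendsto_0: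
  fixes D :: "nat \<Rightarrow> 'a \<Rightarrow> real"
  assumes T: "T \<in> measurable M M" "distr M M T = M"
    and D: "\<And>n \<omega>. \<omega> \<in> space M \<Longrightarrow> 0 \<le> D n \<omega>" "\<And>n \<omega>. \<omega> \<in> space M \<Longrightarrow> D n \<omega> \<le> C"
    and D_add: "\<And>i m \<omega>. \<omega> \<in> space M \<Longrightarrow> D (i + m) \<omega> \<le> D m ((T ^^ i) \<omega>)"
    and g[measurable]: "\<And>n. g n \<in> borel_measurable M" and D_g: "\<And>n. AE \<omega> in M. D n \<omega> = g n \<omega>"
    and lim: "(\<lambda>n. expectation (g n)) \<longlonglongrightarrow> 0"
  shows "AE \<omega> in M. (\<lambda>n. (1 / real n) * (\<Sum>i=1..n. D i \<omega>)) \<longlonglongrightarrow> 0"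
proof -
  note [measurable] = measurable_funpow[OF T(1)]
  have "AE \<omega> in M. 0 \<le> g n \<omega> \<and> norm (g n \<omega>) \<le> C" for n
    using D_g[of n] AE_space
  proof eventually_elim
    fix \<omega> assume "D n \<omega> = g n \<omega>" "\<omega> \<in> space M"
    then show "0 \<le> g n \<omega> \<and> norm (g n \<omega>) \<le> C"
      using D[of \<omega> n] by simp
  qed
  then have g_bounds: "AE \<omega> in M. 0 \<le> g n \<omega>" "AE \<omega> in M. norm (g n \<omega>) \<le> C" for n
    by (simp_all add: AE_conj_iff)
  have g_int: "integrable M (g n)" for n
    using g_bounds(2) by (rule integrable_const_bound) simp
  \<comment> \<open>Each iterate of \<open>T\<close> preserves the measure, so it pulls the null set
    where \<open>D m\<close> and \<open>g m\<close> differ back to a null set.\<close>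
  have "AE \<omega> in M. D m ((T ^^ i) \<omega>) = g m ((T ^^ i) \<omega>)" for i m
    by (rule AE_distrD[OF measurable_funpow[OF T(1)], unfolded distr_funpow[OF T], OF D_g])
  then have D_g_T: "AE \<omega> in M. \<forall>m i. D m ((T ^^ i) \<omega>) = g m ((T ^^ i) \<omega>)"
    by (simp add: AE_all_countable)
  have ev: "AE \<omega> in M. \<forall>\<^sub>F n in sequentially. (1 / real n) * (\<Sum>i=1..n. D i \<omega>) < 2 * c" if c: "0 < c" for c
  proof -
    \<comment> \<open>The measure of \<open>U m\<close> is at most
      \<open>expectation (g m) / c\<close>, which tends to 0. Almost every \<open>\<omega>\<close>
      therefore avoids \<open>U m\<close> for some \<open>m\<close> depending on
      \<open>\<omega>\<close>.\<close>
    define U where "U m = {\<omega>\<in>space M. \<exists>n. real n * c < (\<Sum>i<n. g m ((T ^^ i) \<omega>))}" for m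
    have [measurable]: "U m \<in> sets M" for m
      unfolding U_def by measurable
    have "prob (\<Inter>m. U m) \<le> expectation (g m) / c" for m
    proof -
      have "prob (\<Inter>m. U m) \<le> prob (U m)"
        by (intro finite_measure_mono) auto
      also have "\<dots> \<le> expectation (g m) / c"
        unfolding U_def by (intro maximal_ergodic_inequality T g_int g_bounds c)
      finally show ?thesis .
    qed
    moreover have "(\<lambda>m. expectation (g m) / c) \<longlonglongrightarrow> 0"
      using tendsto_divide[OF lim tendsto_const[of c]] c by simp
    ultimately have "prob (\<Inter>m. U m) \<le> 0"
      by (intro LIMSEQ_le_const) auto
    then have "prob (\<Inter>m. U m) = 0"
      using measure_nonneg[of M "\<Inter>m. U m"] by linarith
    then have "(\<Inter>m. U m) \<in> null_sets M"
      by (intro null_setsI) (simp_all add: emeasure_eq_measure)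
    then have "AE \<omega> in M. \<omega> \<notin> (\<Inter>m. U m)"
      by (rule AE_not_in)
    then show ?thesis
      using D_g_T AE_space
    proof eventually_elim
      fix \<omega> assume \<omega>: "\<omega> \<notin> (\<Inter>m. U m)" "\<forall>m i. D m ((T ^^ i) \<omega>) = g m ((T ^^ i) \<omega>)" "\<omega> \<in> space M"
      then obtain m where m: "\<And>n. (\<Sum>i<n. D m ((T ^^ i) \<omega>)) \<le> real n * c"
        by (auto simp: U_def not_less)
      \<comment> \<open>The first \<open>m\<close> terms contribute a constant that averaging
        removes; the others fall under \<open>D_add\<close>.\<close>
      have "(\<Sum>i<m + n. D i \<omega>) \<le> real m * C + (\<Sum>i<n. D (i + m) \<omega>)" for n
      proof (induction n)
        case 0
        show ?case
          using sum_bounded_above[of "{..<m}" "\<lambda>i. D i \<omega>" C] D(2)[OF \<omega>(3)] by simp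
      qed (simp add: add.commute)
      note split = this
      have bound: "(1 / real n) * (\<Sum>i=1..n. D i \<omega>) \<le> (1 / real n) * (real m * C + real (Suc n) * c)" for n
      proof (rule mult_left_mono)
        \<comment> \<open>Taking \<open>Suc n\<close> further terms covers the index
          \<open>n\<close> even if \<open>m = 0\<close>; the extra terms are nonnegative.\<close>
        have "(\<Sum>i=1..n. D i \<omega>) \<le> (\<Sum>i<m + Suc n. D i \<omega>)"
          using D(1)[OF \<omega>(3)] by (intro sum_mono2) auto
        also have "\<dots> \<le> real m * C + (\<Sum>i<Suc n. D (i + m) \<omega>)"
          by (rule split)
        also have "(\<Sum>i<Suc n. D (i + m) \<omega>) \<le> (\<Sum>i<Suc n. D m ((T ^^ i) \<omega>))"
          by (intro sum_mono D_add \<omega>)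
        also have "\<dots> \<le> real (Suc n) * c"
          by (rule m)
        finally show "(\<Sum>i=1..n. D i \<omega>) \<le> real m * C + real (Suc n) * c" by simp
      qed simp
      have "(\<lambda>n. (1 / real n) * (real m * C + real (Suc n) * c)) \<longlonglongrightarrow> c"
        by real_asymp
      then have "\<forall>\<^sub>F n in sequentially. (1 / real n) * (real m * C + real (Suc n) * c) < 2 * c"
        using c by (intro order_tendstoD(2)) auto
      then show "\<forall>\<^sub>F n in sequentially. (1 / real n) * (\<Sum>i=1..n. D i \<omega>) < 2 * c"
        by eventually_elim (use bound in \<open>rule le_less_trans\<close>)
    qed
  qed
  \<comment> \<open>Countably many thresholds suffice and keep the exceptional set null.\<close>
  have "AE \<omega> in M. \<forall>k. \<forall>\<^sub>F n in sequentially. (1 / real n) * (\<Sum>i=1..n. D i \<omega>) < 2 * (1 / real (Suc k))"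
    unfolding AE_all_countable by (intro allI ev) simp
  then show ?thesis
    using AE_space
  proof eventually_elim
    fix \<omega> assume *: "\<forall>k. \<forall>\<^sub>F n in sequentially. (1 / real n) * (\<Sum>i=1..n. D i \<omega>) < 2 * (1 / real (Suc k))"
      and \<omega>: "\<omega> \<in> space M"
    show "(\<lambda>n. (1 / real n) * (\<Sum>i=1..n. D i \<omega>)) \<longlonglongrightarrow> 0"
    proof (rule order_tendstoI)
      fix a :: real assume "a < 0"
      moreover have "0 \<le> (1 / real n) * (\<Sum>i=1..n. D i \<omega>)" for n
        using D(1)[OF \<omega>] by (intro mult_nonneg_nonneg sum_nonneg) auto
      ultimately show "\<forall>\<^sub>F n in sequentially. a < (1 / real n) * (\<Sum>i=1..n. D i \<omega>)"
        by (intro always_eventually allI) (rule less_le_trans)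
    next
      fix a :: real assume "0 < a"
      then obtain k where k: "2 * (1 / real (Suc k)) < a"
        using reals_Archimedean[of "a / 2"] by (auto simp: field_simps)
      from *[rule_format, of k] show "\<forall>\<^sub>F n in sequentially. (1 / real n) * (\<Sum>i=1..n. D i \<omega>) < a"
        by eventually_elim (use k in linarith)
    qed
  qed
qed

text \<open>Dominated convergence carries the limit over to the averages of the expectations, and
  each term of a decreasing sequence is at most the average up to it.\<close>

lemma (in prob_space) expectation_tendsto_0_of_average:
  fixes g :: "nat \<Rightarrow> 'a \<Rightarrow> real"
  assumes g[measurable]: "\<And>n. g n \<in> borel_measurable M"
    and g_bounds: "\<And>n. AE \<omega> in M. 0 \<le> g n \<omega>" "\<And>n. AE \<omega> in M. g n \<omega> \<le> C"
    and dec: "decseq (\<lambda>n. expectation (g n))"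
    and lim: "AE \<omega> in M. (\<lambda>n. (1 / real n) * (\<Sum>i=1..n. g i \<omega>)) \<longlonglongrightarrow> 0"
  shows "(\<lambda>n. expectation (g n)) \<longlonglongrightarrow> 0"
proof -
  have bounds: "AE \<omega> in M. \<forall>n. 0 \<le> g n \<omega> \<and> g n \<omega> \<le> C"
    using g_bounds by (simp add: AE_all_countable)
  have g_int: "integrable M (g n)" for n
  proof (rule integrable_const_bound)
    show "AE \<omega> in M. norm (g n \<omega>) \<le> C"
      using bounds by eventually_elim (simp add: abs_of_nonneg)
  qed simp
  have "(\<lambda>n. expectation (\<lambda>\<omega>. (1 / real n) * (\<Sum>i=1..n. g i \<omega>))) \<longlonglongrightarrow> expectation (\<lambda>_. 0)"
  proof (rule integral_dominated_convergence)
    show "AE \<omega> in M. norm ((1 / real n) * (\<Sum>i=1..n. g i \<omega>)) \<le> C" for n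
      using bounds
    proof eventually_elim
      fix \<omega> assume *: "\<forall>n. 0 \<le> g n \<omega> \<and> g n \<omega> \<le> C"
      \<comment> \<open>This settles \<open>n = 0\<close>, where the average is 0 because
        \<open>1 / real 0 = 0\<close>.\<close>
      then have "0 \<le> C" by (meson order_trans)
      have "0 \<le> (\<Sum>i=1..n. g i \<omega>)" "(\<Sum>i=1..n. g i \<omega>) \<le> real n * C"
        using * sum_bounded_above[of "{1..n}" "\<lambda>i. g i \<omega>" C] by (auto intro: sum_nonneg)
      then show "norm ((1 / real n) * (\<Sum>i=1..n. g i \<omega>)) \<le> C"
        using \<open>0 \<le> C\<close> by (cases "n = 0") (simp_all add: abs_of_nonneg field_simps)
    qed
  qed (use lim in simp_all)
  then have mean: "(\<lambda>n. (1 / real n) * (\<Sum>i=1..n. expectation (g i))) \<longlonglongrightarrow> 0"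
    using g_int by simp
  show ?thesis
  proof (rule tendsto_sandwich[OF _ _ tendsto_const mean])
    show "\<forall>\<^sub>F n in sequentially. 0 \<le> expectation (g n)"
      by (intro always_eventually allI integral_nonneg_AE g_bounds(1))
    show "\<forall>\<^sub>F n in sequentially. expectation (g n) \<le> (1 / real n) * (\<Sum>i=1..n. expectation (g i))"
      using eventually_gt_at_top[of 0]
    proof eventually_elim
      fix n :: nat assume "0 < n"
      have "real n * expectation (g n) \<le> (\<Sum>i=1..n. expectation (g i))"
        using sum_bounded_below[of "{1..n}" "expectation (g n)" "\<lambda>i. expectation (g i)"] decseqD[OF dec]
        by simp
      with \<open>0 < n\<close> show "expectation (g n) \<le> (1 / real n) * (\<Sum>i=1..n. expectation (g i))"
        by (simp add: field_simps)
    qed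
  qed
qed

text \<open>Monotonicity gives an almost sure limit \<open>l \<ge> 0\<close>, and dominated
  convergence makes \<open>expectation l\<close> the limit of the expectations. A nonnegative
  \<open>l\<close> vanishes almost surely iff its expectation is 0.\<close>

lemma (in prob_space) AE_decseq_tendsto_0_iff:
  fixes P p :: "nat \<Rightarrow> 'a \<Rightarrow> real"
  assumes P: "\<And>n \<omega>. \<omega> \<in> space M \<Longrightarrow> 0 \<le> P n \<omega>" "\<And>n \<omega>. \<omega> \<in> space M \<Longrightarrow> P n \<omega> \<le> C"
    and dec: "\<And>\<omega>. \<omega> \<in> space M \<Longrightarrow> decseq (\<lambda>n. P n \<omega>)"
    and p[measurable]: "\<And>n. p n \<in> borel_measurable M" and P_p: "\<And>n. AE \<omega> in M. P n \<omega> = p n \<omega>"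
  shows "(AE \<omega> in M. (\<lambda>n. P n \<omega>) \<longlonglongrightarrow> 0) \<longleftrightarrow> (\<lambda>n. expectation (p n)) \<longlonglongrightarrow> 0"
proof -
  define l where "l \<omega> = lim (\<lambda>n. p n \<omega>)" for \<omega>
  have [measurable]: "l \<in> borel_measurable M"
    unfolding l_def by measurable
  have "AE \<omega> in M. \<forall>n. P n \<omega> = p n \<omega>"
    using P_p by (simp add: AE_all_countable)
  then have AE: "AE \<omega> in M. (\<forall>n. P n \<omega> = p n \<omega>) \<and> (\<forall>n. norm (p n \<omega>) \<le> C) \<and> (\<lambda>n. p n \<omega>) \<longlonglongrightarrow> l \<omega> \<and> 0 \<le> l \<omega>"
    using AE_space
  proof eventually_elim
    fix \<omega> assume *: "\<forall>n. P n \<omega> = p n \<omega>" "\<omega> \<in> space M"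
    have "(\<lambda>n. P n \<omega>) = (\<lambda>n. p n \<omega>)"
      using *(1) by auto
    then have "decseq (\<lambda>n. p n \<omega>)"
      using dec[OF *(2)] by simp
    moreover have ge: "\<And>n. 0 \<le> p n \<omega>"
      using P(1)[OF *(2)] * by simp
    ultimately obtain L where "(\<lambda>n. p n \<omega>) \<longlonglongrightarrow> L"
      using decseq_convergent[of "\<lambda>n. p n \<omega>" 0] by blast
    then have "(\<lambda>n. p n \<omega>) \<longlonglongrightarrow> l \<omega>"
      unfolding l_def by (simp add: limI)
    moreover from this ge have "0 \<le> l \<omega>"
      by (intro LIMSEQ_le_const) auto
    moreover have "\<forall>n. norm (p n \<omega>) \<le> C"
      using ge P(2)[OF *(2)] * by (simp add: abs_of_nonneg)
    ultimately show "(\<forall>n. P n \<omega> = p n \<omega>) \<and> (\<forall>n. norm (p n \<omega>) \<le> C) \<and> (\<lambda>n. p n \<omega>) \<longlonglongrightarrow> l \<omega> \<and> 0 \<le> l \<omega>"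
      using *(1) by blast
  qed
  have lim: "(\<lambda>n. expectation (p n)) \<longlonglongrightarrow> expectation l" and l_int: "integrable M l"
  proof -
    have 1: "AE \<omega> in M. (\<lambda>n. p n \<omega>) \<longlonglongrightarrow> l \<omega>"
      using AE by eventually_elim simp
    have 2: "AE \<omega> in M. norm (p n \<omega>) \<le> C" for n
      using AE by eventually_elim simp
    show "(\<lambda>n. expectation (p n)) \<longlonglongrightarrow> expectation l"
      by (rule integral_dominated_convergence[OF _ _ _ 1 2]) simp_all
    show "integrable M l"
      by (rule integrable_dominated_convergence[OF _ _ _ 1 2]) simp_all
  qed
  have "(AE \<omega> in M. (\<lambda>n. P n \<omega>) \<longlonglongrightarrow> 0) \<longleftrightarrow> (AE \<omega> in M. l \<omega> = 0)"
  proof (rule eventually_subst)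
    show "AE \<omega> in M. ((\<lambda>n. P n \<omega>) \<longlonglongrightarrow> 0) = (l \<omega> = 0)"
      using AE
    proof eventually_elim
      fix \<omega> assume *: "(\<forall>n. P n \<omega> = p n \<omega>) \<and> (\<forall>n. norm (p n \<omega>) \<le> C) \<and> (\<lambda>n. p n \<omega>) \<longlonglongrightarrow> l \<omega> \<and> 0 \<le> l \<omega>"
      then have "(\<lambda>n. P n \<omega>) \<longlonglongrightarrow> l \<omega>" by simp
      then show "((\<lambda>n. P n \<omega>) \<longlonglongrightarrow> 0) = (l \<omega> = 0)"
        using LIMSEQ_unique by metis
    qed
  qed
  also have "\<dots> \<longleftrightarrow> expectation l = 0"
    using AE l_int by (intro integral_nonneg_eq_0_iff_AE[symmetric]) auto
  also have "\<dots> \<longleftrightarrow> (\<lambda>n. expectation (p n)) \<longlonglongrightarrow> 0"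
    using lim LIMSEQ_unique by auto
  finally show ?thesis .
qed

section \<open>Diameters of images under random products\<close>

lemma compact_countable_dense:
  fixes X :: "'x::metric_space set"
  assumes "compact X"
  obtains D where "countable D" "\<And>x e. x \<in> X \<Longrightarrow> 0 < e \<Longrightarrow> \<exists>c\<in>D. dist x c < e"
proof -
  have "\<forall>n. \<exists>k. finite k \<and> X \<subseteq> (\<Union>x\<in>k. ball x (1 / real (Suc n)))"
    using assms unfolding compact_eq_totally_bounded by simp
  then obtain k where k: "\<And>n. finite (k n)" "\<And>n. X \<subseteq> (\<Union>x\<in>k n. ball x (1 / real (Suc n)))"
    by metis
  show thesis
  proof (rule that)
    show "countable (\<Union>n. k n)"
      using k(1) by (intro countable_UN) (auto intro: countable_finite)
    fix x and e :: real assume "x \<in> X" "0 < e"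
    obtain n where n: "1 / real (Suc n) < e"
      using reals_Archimedean[OF \<open>0 < e\<close>] by (auto simp: inverse_eq_divide)
    from k(2)[of n] \<open>x \<in> X\<close> obtain c where "c \<in> k n" "dist c x < 1 / real (Suc n)"
      by (auto simp: subset_iff)
    then show "\<exists>c\<in>\<Union>n. k n. dist x c < e"
      using n by (intro bexI[of _ c]) (auto simp: dist_commute)
  qed
qed

text \<open>The type \<open>'x\<close> need not be second countable, so \<open>dist\<close> need not be measurable for
  the product of the Borel algebras; on a compact set it is a countable supremum of
  measurable functions.\<close>

lemma measurable_dist_gt_compact:
  fixes X :: "'x::metric_space set"
  assumes X: "compact X"
    and u: "u \<in> measurable N (restrict_space borel X)" and v: "v \<in> measurable N (restrict_space borel X)"
  shows "{z\<in>space N. a < dist (u z) (v z)} \<in> sets N"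
proof -
  obtain D where D: "countable D" "\<And>x e. x \<in> X \<Longrightarrow> 0 < e \<Longrightarrow> \<exists>c\<in>D. dist x c < e"
    using compact_countable_dense[OF X] by blast
  have ub: "u \<in> borel_measurable N" "v \<in> borel_measurable N"
    using u v by (simp_all add: measurable_restrict_space2_iff)
  have dist_c: "(\<lambda>x. dist x c) \<in> borel_measurable borel" for c :: 'x
    by (intro borel_measurable_continuous_onI continuous_intros)
  have [measurable]: "(\<lambda>z. dist (u z) c) \<in> borel_measurable N" "(\<lambda>z. dist (v z) c) \<in> borel_measurable N" for c
    using measurable_compose[OF ub(1) dist_c] measurable_compose[OF ub(2) dist_c] by auto
  \<comment> \<open>By the triangle inequality \<open>dist x y\<close> is the supremum of
    \<open>dist y c - dist x c\<close> over \<open>c \<in> D\<close>, approached when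
    \<open>c\<close> is close to \<open>x\<close>.\<close>
  have "{z\<in>space N. a < dist (u z) (v z)} = (\<Union>c\<in>D. {z\<in>space N. a < dist (v z) c - dist (u z) c})"
  proof (intro equalityI subsetI)
    fix z assume z: "z \<in> {z\<in>space N. a < dist (u z) (v z)}"
    then have "u z \<in> X"
      using measurable_space[OF u] by (simp add: space_restrict_space)
    \<comment> \<open>Half of the excess over \<open>a\<close>, since replacing \<open>u z\<close>
      by \<open>c\<close> costs at most twice their distance.\<close>
    then obtain c where c: "c \<in> D" "dist (u z) c < (dist (u z) (v z) - a) / 2"
      using D(2)[of "u z" "(dist (u z) (v z) - a) / 2"] z by auto
    have "a < dist (v z) c - dist (u z) c"
      using c(2) dist_triangle2[of "u z" "v z" c] by (simp add: field_simps)
    with c(1) z show "z \<in> (\<Union>c\<in>D. {z\<in>space N. a < dist (v z) c - dist (u z) c})"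
      by auto
  next
    fix z assume "z \<in> (\<Union>c\<in>D. {z\<in>space N. a < dist (v z) c - dist (u z) c})"
    then obtain c where "z \<in> space N" "a < dist (v z) c - dist (u z) c" by blast
    then show "z \<in> {z\<in>space N. a < dist (u z) (v z)}"
      using dist_triangle[of "v z" c "u z"] by (simp add: dist_commute)
  qed
  moreover have "\<dots> \<in> sets N"
    using D(1) by (intro sets.countable_UN') auto
  ultimately show ?thesis by simp
qed

text \<open>The condition \<open>0 \<le> a\<close> covers empty \<open>S\<close>, whose diameter is
  0 by convention although it contains no pair of points.\<close>

lemma less_diameter_iff:
  fixes S :: "'x::metric_space set"
  assumes "bounded S" "0 \<le> a"
  shows "a < diameter S \<longleftrightarrow> (\<exists>x\<in>S. \<exists>y\<in>S. a < dist x y)"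
proof
  assume a: "a < diameter S"
  show "\<exists>x\<in>S. \<exists>y\<in>S. a < dist x y"
  proof (rule ccontr)
    assume "\<not> (\<exists>x\<in>S. \<exists>y\<in>S. a < dist x y)"
    then have "diameter S \<le> a"
      using assms(2) by (auto simp: diameter_def not_less intro!: cSUP_least)
    with a show False by simp
  qed
qed (use diameter_bounded_bound[OF assms(1)] in \<open>blast intro: less_le_trans\<close>)

lemma measurable_diameter_image:
  fixes X :: "'x::metric_space set"
  assumes M: "finite_measure M" and X: "compact X"
    and F: "(\<lambda>(\<omega>, x). F \<omega> x) \<in> measurable (M \<Otimes>\<^sub>M restrict_space borel X) (restrict_space borel X)"
  shows "(\<lambda>\<omega>. diameter (F \<omega> ` X)) \<in> borel_measurable (completion M)"
  unfolding borel_measurable_iff_greater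
proof
  fix a :: real
  have FX: "F \<omega> x \<in> X" if "\<omega> \<in> space M" "x \<in> X" for \<omega> x
    using measurable_space[OF F, of "(\<omega>, x)"] that
    by (simp add: space_pair_measure space_restrict_space)
  have bounded: "bounded (F \<omega> ` X)" if "\<omega> \<in> space M" for \<omega>
    using bounded_subset[OF compact_imp_bounded[OF X]] FX[OF that] by blast
  show "{\<omega>\<in>space (completion M). a < diameter (F \<omega> ` X)} \<in> sets (completion M)"
  proof (cases "0 \<le> a")
    case False
    then have "a < diameter (F \<omega> ` X)" if "\<omega> \<in> space M" for \<omega>
      using diameter_ge_0[OF bounded[OF that]] by linarith
    then have "{\<omega>\<in>space (completion M). a < diameter (F \<omega> ` X)} = space (completion M)"
      by auto
    then show ?thesis
      by (metis sets.top)
  next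
    case True
    \<comment> \<open>The Borel algebra of the product space, so that \<open>X \<times> X\<close> is
      a single compact factor for the projection theorem; its coordinate maps are continuous, hence
      measurable.\<close>
    let ?XX = "restrict_space borel (X \<times> X)"
    let ?N = "M \<Otimes>\<^sub>M ?XX"
    let ?F = "\<lambda>\<pi> z. F (fst z) (\<pi> (snd z))"
    have F_meas: "?F \<pi> \<in> measurable ?N (restrict_space borel X)"
      if \<pi>: "\<pi> \<in> borel_measurable borel" "\<And>p. p \<in> X \<times> X \<Longrightarrow> \<pi> p \<in> X" for \<pi> :: "'x \<times> 'x \<Rightarrow> 'x"
    proof -
      have "\<pi> \<in> measurable ?XX (restrict_space borel X)"
        using \<pi> by (intro measurable_restrict_space2 measurable_restrict_space1)
          (auto simp: space_restrict_space)
      then have "(\<lambda>z. (fst z, \<pi> (snd z))) \<in> measurable ?N (M \<Otimes>\<^sub>M restrict_space borel X)"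
        by (intro measurable_Pair measurable_fst measurable_compose[OF measurable_snd])
      from measurable_compose[OF this F] show ?thesis by simp
    qed
    have cont: "fst \<in> borel_measurable (borel :: ('x \<times> 'x) measure)" "snd \<in> borel_measurable (borel :: ('x \<times> 'x) measure)"
      by (intro borel_measurable_continuous_onI continuous_intros)+
    let ?A = "{z\<in>space ?N. a < dist (?F fst z) (?F snd z)}"
    have "?A \<in> sets ?N"
      using cont by (intro measurable_dist_gt_compact[OF X] F_meas) auto
    then have "fst ` ?A \<in> sets (completion M)"
      by (rule measurable_projection[OF M compact_Times[OF X X]])
    moreover have "fst ` ?A = {\<omega>\<in>space (completion M). a < diameter (F \<omega> ` X)}"
    proof (intro equalityI subsetI)
      fix \<omega> assume "\<omega> \<in> fst ` ?A"
      then obtain x y where "\<omega> \<in> space M" "x \<in> X" "y \<in> X" "a < dist (F \<omega> x) (F \<omega> y)"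
        by (auto simp: space_pair_measure space_restrict_space)
      then show "\<omega> \<in> {\<omega>\<in>space (completion M). a < diameter (F \<omega> ` X)}"
        using less_diameter_iff[OF bounded True] by auto
    next
      fix \<omega> assume \<omega>: "\<omega> \<in> {\<omega>\<in>space (completion M). a < diameter (F \<omega> ` X)}"
      then obtain x y where "x \<in> X" "y \<in> X" "a < dist (F \<omega> x) (F \<omega> y)"
        using less_diameter_iff[OF bounded True] by auto
      with \<omega> show "\<omega> \<in> fst ` ?A"
        by (intro image_eqI[of _ _ "(\<omega>, x, y)"]) (auto simp: space_pair_measure space_restrict_space)
    qed
    ultimately show ?thesis by simp
  qed
qed

section \<open>Cocycle identities\<close>

lemma random_product_add:
  "random_product \<theta> f (i + m) \<omega> = random_product \<theta> f m ((\<theta> ^^ i) \<omega>) \<circ> random_product \<theta> f i \<omega>"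
proof (induction m)
  case (Suc m)
  have "(\<theta> ^^ m) ((\<theta> ^^ i) \<omega>) = (\<theta> ^^ (i + m)) \<omega>"
    by (simp add: funpow_add add.commute[of i m])
  with Suc show ?case by (simp add: comp_assoc)
qed simp

text \<open>The forward orbit of \<open>(\<tau> ^^ n) \<omega>\<close> runs back through the earlier
  \<open>\<tau>\<close>-iterates up to \<open>\<tau> \<omega>\<close>. Increasing \<open>n\<close>
  adds a first factor to the forward product, which the cocycle identity with \<open>i = 1\<close>
  splits off.\<close>

lemma pullback_product_eq_random_product:
  assumes \<tau>: "\<And>\<omega>. \<omega> \<in> S \<Longrightarrow> \<tau> \<omega> \<in> S" "\<And>\<omega>. \<omega> \<in> S \<Longrightarrow> \<theta> (\<tau> \<omega>) = \<omega>" and \<omega>: "\<omega> \<in> S"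
  shows "pullback_product \<tau> f n \<omega> = random_product \<theta> f n ((\<tau> ^^ n) \<omega>)"
proof (induction n)
  case (Suc n)
  have "(\<tau> ^^ n) \<omega> \<in> S" for n
    by (induction n) (simp_all add: \<tau> \<omega>)
  then have "\<theta> ((\<tau> ^^ Suc n) \<omega>) = (\<tau> ^^ n) \<omega>"
    by (simp add: \<tau>)
  then show ?case
    using random_product_add[of \<theta> f 1 n "(\<tau> ^^ Suc n) \<omega>"] Suc by simp
qed simp

lemma measurable_random_product:
  assumes \<theta>: "\<theta> \<in> measurable M M"
    and f: "(\<lambda>(\<omega>, x). f \<omega> x) \<in> measurable (M \<Otimes>\<^sub>M N) N"
  shows "(\<lambda>(\<omega>, x). random_product \<theta> f n \<omega> x) \<in> measurable (M \<Otimes>\<^sub>M N) N"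
proof (induction n)
  case 0
  show ?case by (simp add: case_prod_unfold)
next
  case (Suc n)
  have "\<theta> ^^ n \<in> measurable M M"
    by (rule measurable_funpow[OF \<theta>])
  then have "(\<lambda>z. ((\<theta> ^^ n) (fst z), random_product \<theta> f n (fst z) (snd z))) \<in> measurable (M \<Otimes>\<^sub>M N) (M \<Otimes>\<^sub>M N)"
    using Suc by (intro measurable_Pair measurable_compose[OF measurable_fst]) (simp_all add: case_prod_unfold)
  from measurable_compose[OF this f] show ?case
    by (simp add: case_prod_unfold)
qed

theorem theorem4:
  fixes M :: "'w measure"
    and \<theta> :: "'w \<Rightarrow> 'w"
    and X :: "'x::metric_space set"
    and f :: "'w \<Rightarrow> 'x \<Rightarrow> 'x"
  assumes "prob_space M"
    and "\<theta> \<in> measurable M M"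
    and "distr M M \<theta> = M"
    and "bij_betw \<theta> (space M) (space M)"
    and "inv_into (space M) \<theta> \<in> measurable M M"
    and "compact X"
    and "(\<lambda>(\<omega>, x). f \<omega> x) \<in> measurable (M \<Otimes>\<^sub>M restrict_space borel X) (restrict_space borel X)"
  shows "(AE \<omega> in M. (\<lambda>n. diameter (pullback_product (inv_into (space M) \<theta>) f n \<omega> ` X)) \<longlonglongrightarrow> 0)
    \<longleftrightarrow> (AE \<omega> in M. (\<lambda>n. (1 / real n) * (\<Sum>i=1..n. diameter (random_product \<theta> f i \<omega> ` X))) \<longlonglongrightarrow> 0)"
proof -
  interpret prob_space M by fact
  note \<theta> = assms(2,3) and bij = assms(4) and X = assms(6) and f = assms(7)

  \<comment> \<open>The inverse base map preserves the measure\<close>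
  define \<tau> where "\<tau> = inv_into (space M) \<theta>"
  have \<tau>_meas: "\<tau> \<in> measurable M M"
    unfolding \<tau>_def by (rule assms(5))
  have \<tau>: "\<tau> \<omega> \<in> space M" "\<theta> (\<tau> \<omega>) = \<omega>" "\<tau> (\<theta> \<omega>) = \<omega>" if "\<omega> \<in> space M" for \<omega>
    using that bij_betw_inv_into[OF bij] bij_betw_inv_into_right[OF bij] bij_betw_inv_into_left[OF bij]
    unfolding \<tau>_def by (auto dest: bij_betwE)
  have "distr M M \<tau> = distr (distr M M \<theta>) M \<tau>"
    by (simp add: \<theta>)
  also have "\<dots> = distr M M (\<lambda>\<omega>. \<omega>)"
    unfolding distr_distr[OF \<tau>_meas \<theta>(1)] by (rule distr_cong) (simp_all add: \<tau>)
  finally have \<tau>_distr: "distr M M \<tau> = M"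
    by simp
  note \<tau>_funpow = measurable_funpow[OF \<tau>_meas] distr_funpow[OF \<tau>_meas \<tau>_distr]

  \<comment> \<open>Bounds and monotonicity of the diameters\<close>
  define D where "D n \<omega> = diameter (random_product \<theta> f n \<omega> ` X)" for n \<omega>
  define P where "P n \<omega> = diameter (pullback_product \<tau> f n \<omega> ` X)" for n \<omega>
  note rp_meas = measurable_random_product[OF \<theta>(1) f]
  have rp_X: "random_product \<theta> f n \<omega> ` X \<subseteq> X" if "\<omega> \<in> space M" for n \<omega>
    using measurable_space[OF rp_meas, of "(\<omega>, _)"] that
    by (auto simp: space_pair_measure space_restrict_space)
  have diam_mono: "diameter A \<le> diameter B" if "A \<subseteq> B" "B \<subseteq> X" for A B
    using that bounded_subset[OF compact_imp_bounded[OF X]] by (intro diameter_subset) auto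
  \<comment> \<open>The lower bound compares the image with the empty set, of diameter 0.\<close>
  have D_bounds: "0 \<le> D n \<omega>" "D n \<omega> \<le> diameter X" if "\<omega> \<in> space M" for n \<omega>
    unfolding D_def using diam_mono[of "{}"] diam_mono[of _ X] rp_X[OF that, of n] by auto
  have \<theta>_space: "(\<theta> ^^ i) \<omega> \<in> space M" and \<tau>_space: "(\<tau> ^^ i) \<omega> \<in> space M" if "\<omega> \<in> space M" for i \<omega>
    using that measurable_space[OF measurable_funpow[OF \<theta>(1)]] measurable_space[OF \<tau>_funpow(1)]
    by auto
  have D_add: "D (i + m) \<omega> \<le> D m ((\<theta> ^^ i) \<omega>)" if "\<omega> \<in> space M" for i m \<omega>
    unfolding D_def random_product_add image_comp[symmetric]
    by (intro diam_mono image_mono rp_X \<theta>_space that)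
  have P_D: "P n \<omega> = D n ((\<tau> ^^ n) \<omega>)" if "\<omega> \<in> space M" for n \<omega>
    unfolding P_def D_def using pullback_product_eq_random_product[of "space M" \<tau> \<theta> \<omega> f n] \<tau> that
    by simp
  have P_bounds: "0 \<le> P n \<omega>" "P n \<omega> \<le> diameter X" if "\<omega> \<in> space M" for n \<omega>
    using P_D D_bounds \<tau>_space that by auto
  have P_dec: "decseq (\<lambda>n. P n \<omega>)" if "\<omega> \<in> space M" for \<omega>
    unfolding decseq_Suc_iff
  proof
    fix n
    have "\<theta> ((\<tau> ^^ Suc n) \<omega>) = (\<tau> ^^ n) \<omega>"
      using \<tau>(2)[OF \<tau>_space[OF that]] by simp
    \<comment> \<open>Pullback images are nested: dropping the first map applied after
      \<open>(\<tau> ^^ Suc n) \<omega>\<close> leaves the forward product of length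
      \<open>n\<close> from \<open>(\<tau> ^^ n) \<omega>\<close>.\<close>
    then show "P (Suc n) \<omega> \<le> P n \<omega>"
      using D_add[OF \<tau>_space[OF that], of 1 n "Suc n"] by (simp add: P_D[OF that])
  qed

  \<comment> \<open>Reduction of both conditions to the expectations of measurable versions\<close>
  have "\<forall>n. \<exists>g\<in>borel_measurable M. AE \<omega> in M. D n \<omega> = g \<omega>"
    unfolding D_def
    by (intro allI completion_ex_borel_measurable_real measurable_diameter_image X rp_meas) unfold_locales
  then obtain g where g: "\<And>n. g n \<in> borel_measurable M" and D_g: "\<And>n. AE \<omega> in M. D n \<omega> = g n \<omega>"
    by metis
  \<comment> \<open>A measurable version of \<open>P n\<close>; invariance under
    \<open>\<tau> ^^ n\<close> gives it the same expectation as \<open>g n\<close>.\<close>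
  define p where "p n \<omega> = g n ((\<tau> ^^ n) \<omega>)" for n \<omega>
  have p: "p n \<in> borel_measurable M" for n
    unfolding p_def by (rule measurable_compose[OF \<tau>_funpow(1) g])
  have P_p: "AE \<omega> in M. P n \<omega> = p n \<omega>" for n
  proof -
    have "AE \<omega> in M. D n ((\<tau> ^^ n) \<omega>) = g n ((\<tau> ^^ n) \<omega>)"
      by (rule AE_distrD[OF \<tau>_funpow(1), unfolded \<tau>_funpow(2), OF D_g])
    then show ?thesis
      using AE_space by eventually_elim (simp add: p_def P_D)
  qed
  have p_g: "expectation (p n) = expectation (g n)" for n
    using integral_distr[OF \<tau>_funpow(1)[of n] g[of n]] by (simp add: p_def[abs_def] \<tau>_funpow(2))
  have P_iff: "(AE \<omega> in M. (\<lambda>n. P n \<omega>) \<longlonglongrightarrow> 0) \<longleftrightarrow> (\<lambda>n. expectation (g n)) \<longlonglongrightarrow> 0"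
    unfolding p_g[symmetric] by (rule AE_decseq_tendsto_0_iff[OF P_bounds P_dec p P_p])

  have "(AE \<omega> in M. (\<lambda>n. (1 / real n) * (\<Sum>i=1..n. D i \<omega>)) \<longlonglongrightarrow> 0) \<longleftrightarrow> (\<lambda>n. expectation (g n)) \<longlonglongrightarrow> 0"
  proof
    assume lim: "(\<lambda>n. expectation (g n)) \<longlonglongrightarrow> 0"
    show "AE \<omega> in M. (\<lambda>n. (1 / real n) * (\<Sum>i=1..n. D i \<omega>)) \<longlonglongrightarrow> 0"
      by (rule AE_average_tendsto_0[OF \<theta> D_bounds D_add g D_g lim])
  next
    assume avg: "AE \<omega> in M. (\<lambda>n. (1 / real n) * (\<Sum>i=1..n. D i \<omega>)) \<longlonglongrightarrow> 0"
    have "AE \<omega> in M. \<forall>n. D n \<omega> = g n \<omega>"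
      using D_g by (simp add: AE_all_countable)
    with avg have avg_g: "AE \<omega> in M. (\<lambda>n. (1 / real n) * (\<Sum>i=1..n. g i \<omega>)) \<longlonglongrightarrow> 0"
      by eventually_elim simp
    have nonneg: "AE \<omega> in M. 0 \<le> g n \<omega>" for n
      using D_g[of n] AE_space
    proof eventually_elim
      fix \<omega> assume "D n \<omega> = g n \<omega>" "\<omega> \<in> space M"
      then show "0 \<le> g n \<omega>" using D_bounds(1)[of \<omega> n] by simp
    qed
    have le: "AE \<omega> in M. g n \<omega> \<le> diameter X" for n
      using D_g[of n] AE_space
    proof eventually_elim
      fix \<omega> assume "D n \<omega> = g n \<omega>" "\<omega> \<in> space M"
      then show "g n \<omega> \<le> diameter X" using D_bounds(2)[of \<omega> n] by simp
    qed
    \<comment> \<open>Monotonicity is read off from \<open>p\<close>, which decreases almost surely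
      by nestedness of the pullback images; only the expectations of \<open>g\<close> inherit
      it.\<close>
    have dec: "decseq (\<lambda>n. expectation (g n))"
      unfolding decseq_Suc_iff
    proof
      fix n
      have int: "integrable M (p n)" for n
      proof (rule integrable_const_bound)
        show "AE \<omega> in M. norm (p n \<omega>) \<le> diameter X"
          using P_p[of n] AE_space
        proof eventually_elim
          fix \<omega> assume "P n \<omega> = p n \<omega>" "\<omega> \<in> space M"
          then show "norm (p n \<omega>) \<le> diameter X"
            using P_bounds[of \<omega> n] by simp
        qed
      qed (rule p)
      have "AE \<omega> in M. p (Suc n) \<omega> \<le> p n \<omega>"
        using P_p[of n] P_p[of "Suc n"] AE_space
      proof eventually_elim
        fix \<omega> assume *: "P n \<omega> = p n \<omega>" "P (Suc n) \<omega> = p (Suc n) \<omega>" "\<omega> \<in> space M"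
        show "p (Suc n) \<omega> \<le> p n \<omega>"
          using decseqD[OF P_dec[OF *(3)], of n "Suc n"] * by simp
      qed
      then show "expectation (g (Suc n)) \<le> expectation (g n)"
        unfolding p_g[symmetric] by (intro integral_mono_AE int)
    qed
    show "(\<lambda>n. expectation (g n)) \<longlonglongrightarrow> 0"
      by (rule expectation_tendsto_0_of_average[OF g nonneg le dec avg_g])
  qed
  with P_iff show ?thesis
    unfolding P_def D_def \<tau>_def by simp
qed

end
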